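(* If M-CLP and M-CLP$^*$ are both strictly feasible at $T$, then both M-CLP and M-CLP$^*$ have optimal solutions, and there is no duality gap, i.e. their optimal objective values are equal.
   Context: Let $T>0$, $A$ a constant $K\times J$ matrix, $\beta,b\in\mathbb R^K$, $\gamma,c\in\mathbb R^J$ constant vectors. Superscript $T$ on vectors/matrices is transpose; vector inequalities are componentwise, and "vector $\ge\alpha$" for a scalar $\alpha$ means every component is $\ge\alpha$. M-CLP: maximize $\int_{0-}^T(\gamma+(T-t)c)^{T}dU(t)$ subject to $AU(t)\le\beta+bt$ for $0\le t\le T$, where $U:[0,T]\to\mathbb R^J$ is non-negative, non-decreasing and right-continuous. M-CLP$^*$: minimize $\int_{0-}^T(\beta+(T-t)b)^{T}dP(t)$ subject to $A^{T}P(t)\ge\gamma+ct$ for $0\le t\le T$, where $P:[0,T]\to\mathbb R^K$ is non-negative, non-decreasing and right-continuous. Integrals are Lebesgue–Stieltjes over $[0,T]$ with the convention $U(0-)=0$, $P(0-)=0$, so atoms at $0$ (of sizes $U(0)$, $P(0)$) and at $T$ are included. M-CLP is strictly feasible at $T$ if there exist a feasible $U$ and a constant $\alpha>0$ with $\beta+bt-AU(t)\ge\alpha$ for all $t\in[0,T]$. M-CLP$^*$ is strictly feasible at $T$ if there exist a feasible $P$ and a constant $\alpha>0$ with $A^{T}P(t)-\gamma-ct\ge\alpha$ for all $t\in[0,T]$. *)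

theory Defs
  imports "HOL-Analysis.Analysis"
begin

text \<open>
  The functions of the problems live on \<open>[0,T]\<close> only. The distribution function below encodes the
  convention \<open>u(0-) = 0\<close>: it jumps from 0 to \<open>u 0\<close> at 0 and is constant after \<open>T\<close>, so that for
  non-negative, non-decreasing, right-continuous \<open>u\<close> the associated measure lives on \<open>[0,T]\<close>,
  has an atom of size \<open>u 0\<close> at 0, and includes a possible atom at \<open>T\<close>.
\<close>

definition dist_fun :: "real \<Rightarrow> (real \<Rightarrow> real) \<Rightarrow> real \<Rightarrow> real" where
  "dist_fun T u t = (if t < 0 then 0 else u (min t T))"

definition stieltjes_integral :: "real \<Rightarrow> (real \<Rightarrow> real) \<Rightarrow> (real \<Rightarrow> real) \<Rightarrow> real" where
  "stieltjes_integral T f u = (LINT t:{0..T}|interval_measure (dist_fun T u). f t)"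

definition vec_stieltjes_integral ::
    "real \<Rightarrow> (real \<Rightarrow> real^'n) \<Rightarrow> (real \<Rightarrow> real^'n) \<Rightarrow> real" where
  "vec_stieltjes_integral T f U =
     (\<Sum>i\<in>UNIV. stieltjes_integral T (\<lambda>t. f t $ i) (\<lambda>t. U t $ i))"

text \<open>
  The order on vectors is componentwise. As functions on \<open>[0,T]\<close> are right-continuous at \<open>T\<close>
  trivially, right-continuity is a condition on \<open>[0,T)\<close>.
\<close>

definition admissible :: "real \<Rightarrow> (real \<Rightarrow> real^'n) \<Rightarrow> bool" where
  "admissible T U \<longleftrightarrow>
     (\<forall>t\<in>{0..T}. 0 \<le> U t) \<and> mono_on {0..T} U \<and> (\<forall>t\<in>{0..<T}. continuous (at_right t) U)"

definition mclp_feasible ::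
    "real \<Rightarrow> real^'j^'k \<Rightarrow> real^'k \<Rightarrow> real^'k \<Rightarrow> (real \<Rightarrow> real^'j) \<Rightarrow> bool" where
  "mclp_feasible T A \<beta> b U \<longleftrightarrow>
     admissible T U \<and> (\<forall>t\<in>{0..T}. A *v U t \<le> \<beta> + t *\<^sub>R b)"

definition mclp_objective ::
    "real \<Rightarrow> real^'j \<Rightarrow> real^'j \<Rightarrow> (real \<Rightarrow> real^'j) \<Rightarrow> real" where
  "mclp_objective T \<gamma> c U = vec_stieltjes_integral T (\<lambda>t. \<gamma> + (T - t) *\<^sub>R c) U"

definition mclp_strictly_feasible ::
    "real \<Rightarrow> real^'j^'k \<Rightarrow> real^'k \<Rightarrow> real^'k \<Rightarrow> bool" where
  "mclp_strictly_feasible T A \<beta> b \<longleftrightarrow>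
     (\<exists>U \<alpha>. mclp_feasible T A \<beta> b U \<and> \<alpha> > 0 \<and>
        (\<forall>t\<in>{0..T}. \<forall>k. (\<beta> + t *\<^sub>R b - A *v U t) $ k \<ge> \<alpha>))"

definition mclp_optimal ::
    "real \<Rightarrow> real^'j^'k \<Rightarrow> real^'k \<Rightarrow> real^'k \<Rightarrow> real^'j \<Rightarrow> real^'j \<Rightarrow> (real \<Rightarrow> real^'j) \<Rightarrow> bool" where
  "mclp_optimal T A \<beta> b \<gamma> c U \<longleftrightarrow>
     mclp_feasible T A \<beta> b U \<and>
     (\<forall>V. mclp_feasible T A \<beta> b V \<longrightarrow> mclp_objective T \<gamma> c V \<le> mclp_objective T \<gamma> c U)"

definition mclp_value ::
    "real \<Rightarrow> real^'j^'k \<Rightarrow> real^'k \<Rightarrow> real^'k \<Rightarrow> real^'j \<Rightarrow> real^'j \<Rightarrow> ereal" where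
  "mclp_value T A \<beta> b \<gamma> c =
     (SUP U\<in>{U. mclp_feasible T A \<beta> b U}. ereal (mclp_objective T \<gamma> c U))"

definition mclp_dual_feasible ::
    "real \<Rightarrow> real^'j^'k \<Rightarrow> real^'j \<Rightarrow> real^'j \<Rightarrow> (real \<Rightarrow> real^'k) \<Rightarrow> bool" where
  "mclp_dual_feasible T A \<gamma> c P \<longleftrightarrow>
     admissible T P \<and> (\<forall>t\<in>{0..T}. transpose A *v P t \<ge> \<gamma> + t *\<^sub>R c)"

definition mclp_dual_objective ::
    "real \<Rightarrow> real^'k \<Rightarrow> real^'k \<Rightarrow> (real \<Rightarrow> real^'k) \<Rightarrow> real" where
  "mclp_dual_objective T \<beta> b P = vec_stieltjes_integral T (\<lambda>t. \<beta> + (T - t) *\<^sub>R b) P"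

definition mclp_dual_strictly_feasible ::
    "real \<Rightarrow> real^'j^'k \<Rightarrow> real^'j \<Rightarrow> real^'j \<Rightarrow> bool" where
  "mclp_dual_strictly_feasible T A \<gamma> c \<longleftrightarrow>
     (\<exists>P \<alpha>. mclp_dual_feasible T A \<gamma> c P \<and> \<alpha> > 0 \<and>
        (\<forall>t\<in>{0..T}. \<forall>j. (transpose A *v P t - \<gamma> - t *\<^sub>R c) $ j \<ge> \<alpha>))"

definition mclp_dual_optimal ::
    "real \<Rightarrow> real^'j^'k \<Rightarrow> real^'k \<Rightarrow> real^'k \<Rightarrow> real^'j \<Rightarrow> real^'j \<Rightarrow> (real \<Rightarrow> real^'k) \<Rightarrow> bool" where
  "mclp_dual_optimal T A \<beta> b \<gamma> c P \<longleftrightarrow>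
     mclp_dual_feasible T A \<gamma> c P \<and>
     (\<forall>Q. mclp_dual_feasible T A \<gamma> c Q \<longrightarrow>
        mclp_dual_objective T \<beta> b P \<le> mclp_dual_objective T \<beta> b Q)"

definition mclp_dual_value ::
    "real \<Rightarrow> real^'j^'k \<Rightarrow> real^'k \<Rightarrow> real^'k \<Rightarrow> real^'j \<Rightarrow> real^'j \<Rightarrow> ereal" where
  "mclp_dual_value T A \<beta> b \<gamma> c =
     (INF P\<in>{P. mclp_dual_feasible T A \<gamma> c P}. ereal (mclp_dual_objective T \<beta> b P))"

end

theory Submission
  imports Defs "HOL-Probability.Probability"
begin

text \<open>
  The two problems are limits of finite linear programs that are exactly dual to each other. Take an
  equidistant grid on \<open>[0,T]\<close>, let the controls jump only at grid points and impose the constraints only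
  there. The linear programming dual of the discretised M-CLP, with its time index reversed, is the
  discretised M-CLP\<open>\<^sup>*\<close> (lemma \<open>discrete_near_duality\<close>). Farkas' lemma therefore gives feasible step
  functions on both sides whose objectives differ by an arbitrarily small amount.

  Strict feasibility enters as compactness. A strictly feasible solution of one problem bounds the total
  mass of near-optimal solutions of the other (lemma \<open>lp_near_duality_bounded\<close>), and the bound is uniform
  in the grid. Helly's selection theorem then yields, as the grid is refined, a subsequence along which
  the step functions of both problems converge to admissible functions outside a countable set
  (lemma \<open>monotone_vector_limit\<close>).

  The limits are feasible, since the constraints hold up to the mesh size and pass to the limit, and by
  right-continuity they hold at the exceptional points as well. For the objectives, integration by parts
  gives \<open>\<gamma> \<bullet> U T\<close> plus the inner product of \<open>c\<close> with the Lebesgue integral of \<open>U\<close> over \<open>[0,T]\<close>, so they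
  converge by dominated convergence. Hence the two limits have a duality gap of at most 0. Weak duality
  (lemma \<open>mclp_weak_duality\<close>), which is Fubini's theorem for the convolution of the two controls, gives
  the reverse inequality and the optimality of both limits.
\<close>

section \<open>Duality of finite linear programs\<close>

text \<open>
  This is Bartl's induction on the number of inequalities. If the conclusion already follows
  from the inequalities other than \<open>k\<close>, their multipliers suffice. Otherwise there is a point \<open>x0\<close> that satisfies the others
  and on which \<open>c\<close> is positive, so that \<open>a k\<close> is positive there too; projecting along \<open>x0\<close> onto the
  kernel of \<open>a k\<close> eliminates \<open>k\<close>. Index sets rather than index types carry the dimensions because a
  discretisation is a program whose size varies with the grid.
\<close>

lemma farkas:
  fixes a :: "'m \<Rightarrow> 'n \<Rightarrow> real" and c :: "'n \<Rightarrow> real"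
  assumes "finite M" and "finite N"
    and "\<And>x. (\<And>m. m \<in> M \<Longrightarrow> (\<Sum>n\<in>N. a m n * x n) \<le> 0) \<Longrightarrow> (\<Sum>n\<in>N. c n * x n) \<le> 0"
  shows "\<exists>y. (\<forall>m\<in>M. 0 \<le> y m) \<and> (\<forall>n\<in>N. c n = (\<Sum>m\<in>M. y m * a m n))"
  using assms(1,3)
proof (induction M arbitrary: a c rule: finite_induct)
  case empty
  have "(\<Sum>n\<in>N. c n * c n) \<le> 0"
    using empty.prems[of c] by simp
  then have "(\<Sum>n\<in>N. c n * c n) = 0"
    by (simp add: order_antisym sum_nonneg)
  then show ?case
    using \<open>finite N\<close> by (simp add: sum_nonneg_eq_0_iff)
next
  case (insert k M)
  define dot where "dot f x = (\<Sum>n\<in>N. f n * x n)" for f x :: "'n \<Rightarrow> real"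
  show ?case
  proof (cases "\<forall>x. (\<forall>m\<in>M. dot (a m) x \<le> 0) \<longrightarrow> dot c x \<le> 0")
    case True
    then have "\<exists>y. (\<forall>m\<in>M. 0 \<le> y m) \<and> (\<forall>n\<in>N. c n = (\<Sum>m\<in>M. y m * a m n))"
      unfolding dot_def by (intro insert.IH) auto
    then obtain y where y: "\<forall>m\<in>M. 0 \<le> y m" "\<forall>n\<in>N. c n = (\<Sum>m\<in>M. y m * a m n)"
      by blast
    have "(\<Sum>m\<in>M. (y(k := 0)) m * a m n) = (\<Sum>m\<in>M. y m * a m n)" for n
      using insert.hyps by (intro sum.cong) auto
    with y insert.hyps show ?thesis
      by (intro exI[of _ "y(k := 0)"]) auto
  next
    case False
    then obtain x0 where x0: "\<And>m. m \<in> M \<Longrightarrow> dot (a m) x0 \<le> 0" and c_x0: "dot c x0 > 0"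
      by (auto simp: not_le)
    have ak_x0: "dot (a k) x0 > 0"
      using insert.prems[of x0] x0 c_x0 unfolding dot_def by force
    \<comment> \<open>The functional with row \<open>f\<close> composed with the projection along \<open>x0\<close> onto the kernel of \<open>a k\<close>.\<close>
    define proj where "proj f n = f n - dot f x0 / dot (a k) x0 * a k n" for f n
    have dot_proj: "dot (proj f) x = dot f (\<lambda>n. x n - dot (a k) x / dot (a k) x0 * x0 n)" for f x
    proof -
      have *: "dot (proj f) x = dot f x - dot f x0 / dot (a k) x0 * dot (a k) x"
        unfolding dot_def[of "proj f"] dot_def[of f x] dot_def[of "a k" x] proj_def
        by (simp add: sum_subtractf sum_distrib_left algebra_simps)
      have **: "dot f (\<lambda>n. x n - r * x0 n) = dot f x - r * dot f x0" for r
        by (simp add: dot_def sum_subtractf sum_distrib_left algebra_simps)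
      show ?thesis
        unfolding * ** by simp
    qed
    have "\<exists>y. (\<forall>m\<in>M. 0 \<le> y m) \<and> (\<forall>n\<in>N. proj c n = (\<Sum>m\<in>M. y m * proj (a m) n))"
    proof (rule insert.IH)
      fix x assume "\<And>m. m \<in> M \<Longrightarrow> (\<Sum>n\<in>N. proj (a m) n * x n) \<le> 0"
      then have M: "dot (proj (a m)) x \<le> 0" if "m \<in> M" for m
        using that by (simp add: dot_def)
      have "dot (proj (a k)) x = 0"
        using ak_x0 unfolding dot_def[of "proj _"] proj_def by simp
      with M have "dot (proj (a m)) x \<le> 0" if "m \<in> insert k M" for m
        using that by auto
      then have "dot (proj c) x \<le> 0"
        unfolding dot_proj unfolding dot_def[of _ "\<lambda>n. _ n - _ n"] by (rule insert.prems)
      then show "(\<Sum>n\<in>N. proj c n * x n) \<le> 0"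
        by (simp add: dot_def)
    qed
    then obtain y where y: "\<forall>m\<in>M. 0 \<le> y m"
      and cy: "\<forall>n\<in>N. proj c n = (\<Sum>m\<in>M. y m * proj (a m) n)"
      by blast
    define w where "w = dot c x0 / dot (a k) x0 - (\<Sum>m\<in>M. y m * (dot (a m) x0 / dot (a k) x0))"
    have "(\<Sum>m\<in>M. y m * (dot (a m) x0 / dot (a k) x0)) \<le> 0"
      using y x0 ak_x0 by (intro sum_nonpos mult_nonneg_nonpos divide_nonpos_pos) auto
    moreover have "dot c x0 / dot (a k) x0 > 0"
      using c_x0 ak_x0 by simp
    ultimately have "w \<ge> 0"
      by (simp add: w_def)
    have "c n = w * a k n + (\<Sum>m\<in>M. y m * a m n)" if "n \<in> N" for n
    proof -
      have "c n = dot c x0 / dot (a k) x0 * a k n + (\<Sum>m\<in>M. y m * proj (a m) n)"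
        using bspec[OF cy that] unfolding proj_def[of c] by linarith
      also have "(\<Sum>m\<in>M. y m * proj (a m) n) =
          (\<Sum>m\<in>M. y m * a m n) - (\<Sum>m\<in>M. y m * (dot (a m) x0 / dot (a k) x0)) * a k n"
        by (simp add: proj_def sum_subtractf sum_distrib_left sum_distrib_right algebra_simps)
      finally show ?thesis by (simp add: w_def algebra_simps)
    qed
    moreover have "(\<Sum>m\<in>M. (y(k := w)) m * a m n) = (\<Sum>m\<in>M. y m * a m n)" for n
      using insert.hyps by (intro sum.cong) auto
    ultimately show ?thesis
      using y \<open>w \<ge> 0\<close> insert.hyps by (intro exI[of _ "y(k := w)"]) auto
  qed
qed

text \<open>
  The sign conditions become further rows; their multipliers are the slack between the two sides of
  the conclusion.
\<close>

lemma farkas_nonneg: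
  fixes a :: "'m \<Rightarrow> 'n \<Rightarrow> real" and c :: "'n \<Rightarrow> real"
  assumes fin: "finite M" "finite N"
    and imp: "\<And>x. (\<And>n. n \<in> N \<Longrightarrow> 0 \<le> x n) \<Longrightarrow> (\<And>m. m \<in> M \<Longrightarrow> (\<Sum>n\<in>N. a m n * x n) \<le> 0) \<Longrightarrow>
        (\<Sum>n\<in>N. c n * x n) \<le> 0"
  obtains y where "\<And>m. m \<in> M \<Longrightarrow> 0 \<le> y m" "\<And>n. n \<in> N \<Longrightarrow> c n \<le> (\<Sum>m\<in>M. y m * a m n)"
proof -
  define a' where "a' = case_sum a (\<lambda>n n'. if n' = n then - 1 else 0)"
  have unit: "(\<Sum>n'\<in>N. (if n' = n then - 1 else 0) * x n') = - x n" if "n \<in> N" for n and x :: "'n \<Rightarrow> real"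
    using fin that by (simp add: if_distrib[of "\<lambda>r. r * _"] cong: if_cong)
  have "\<exists>y. (\<forall>m\<in>M <+> N. 0 \<le> y m) \<and> (\<forall>n\<in>N. c n = (\<Sum>m\<in>M <+> N. y m * a' m n))"
  proof (rule farkas)
    fix x assume x: "\<And>m. m \<in> M <+> N \<Longrightarrow> (\<Sum>n\<in>N. a' m n * x n) \<le> 0"
    show "(\<Sum>n\<in>N. c n * x n) \<le> 0"
    proof (rule imp)
      show "0 \<le> x n" if "n \<in> N" for n
        using x[of "Inr n"] unit[OF that] that by (auto simp: a'_def)
      show "(\<Sum>n\<in>N. a m n * x n) \<le> 0" if "m \<in> M" for m
        using x[of "Inl m"] that by (auto simp: a'_def)
    qed
  qed (use fin in auto)
  then obtain y where y: "\<forall>m\<in>M <+> N. 0 \<le> y m" "\<forall>n\<in>N. c n = (\<Sum>m\<in>M <+> N. y m * a' m n)"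
    by blast
  have "c n \<le> (\<Sum>m\<in>M. y (Inl m) * a m n)" if "n \<in> N" for n
  proof -
    have "c n = (\<Sum>m\<in>M. y (Inl m) * a m n) + (\<Sum>n'\<in>N. y (Inr n') * (if n = n' then - 1 else 0))"
      using y(2) that fin by (simp add: sum.Plus a'_def)
    also have "\<dots> \<le> (\<Sum>m\<in>M. y (Inl m) * a m n)"
      using y(1) by (auto intro!: sum_nonpos)
    finally show ?thesis .
  qed
  with y(1) that[of "\<lambda>m. y (Inl m)"] show thesis by auto
qed

lemma lp_weak_duality:
  fixes a :: "'m \<Rightarrow> 'n \<Rightarrow> real"
  assumes "\<And>n. n \<in> N \<Longrightarrow> 0 \<le> x n" "\<And>m. m \<in> M \<Longrightarrow> (\<Sum>n\<in>N. a m n * x n) \<le> b m"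
    and "\<And>m. m \<in> M \<Longrightarrow> 0 \<le> y m" "\<And>n. n \<in> N \<Longrightarrow> c n \<le> (\<Sum>m\<in>M. y m * a m n)"
  shows "(\<Sum>n\<in>N. c n * x n) \<le> (\<Sum>m\<in>M. b m * y m)"
proof -
  have "(\<Sum>n\<in>N. c n * x n) \<le> (\<Sum>n\<in>N. (\<Sum>m\<in>M. y m * a m n) * x n)"
    using assms by (intro sum_mono mult_right_mono) auto
  also have "\<dots> = (\<Sum>m\<in>M. (\<Sum>n\<in>N. a m n * x n) * y m)"
    unfolding sum_distrib_right by (subst sum.swap) (simp add: mult_ac)
  also have "\<dots> \<le> (\<Sum>m\<in>M. b m * y m)"
    using assms by (intro sum_mono mult_right_mono) auto
  finally show ?thesis .
qed

text \<open>
  Let \<open>v\<close> be the supremum of the primal values. Homogenising the system \<open>a x \<le> b\<close> by a further variable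
  \<open>t\<close> (the index \<open>None\<close>), the definition of \<open>v\<close> says that \<open>c x \<le> v t\<close> follows from \<open>a x \<le> b t\<close> and
  \<open>x, t \<ge> 0\<close>; the Farkas multipliers are a dual solution of value at most \<open>v\<close>. The gap \<open>\<epsilon>\<close> comes from
  choosing a primal solution that nearly attains the supremum.
\<close>

lemma lp_near_duality:
  fixes a :: "'m \<Rightarrow> 'n \<Rightarrow> real" and b :: "'m \<Rightarrow> real" and c :: "'n \<Rightarrow> real"
  assumes fin: "finite M" "finite N"
    and x0: "\<And>n. n \<in> N \<Longrightarrow> 0 \<le> x0 n" "\<And>m. m \<in> M \<Longrightarrow> (\<Sum>n\<in>N. a m n * x0 n) \<le> b m"
    and y0: "\<And>m. m \<in> M \<Longrightarrow> 0 \<le> y0 m" "\<And>n. n \<in> N \<Longrightarrow> c n \<le> (\<Sum>m\<in>M. y0 m * a m n)"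
    and "0 < \<epsilon>"
  obtains x y where
    "\<And>n. n \<in> N \<Longrightarrow> 0 \<le> x n" "\<And>m. m \<in> M \<Longrightarrow> (\<Sum>n\<in>N. a m n * x n) \<le> b m"
    "\<And>m. m \<in> M \<Longrightarrow> 0 \<le> y m" "\<And>n. n \<in> N \<Longrightarrow> c n \<le> (\<Sum>m\<in>M. y m * a m n)"
    "(\<Sum>m\<in>M. b m * y m) \<le> (\<Sum>n\<in>N. c n * x n) + \<epsilon>"
proof -
  define feas where "feas x \<longleftrightarrow> (\<forall>n\<in>N. 0 \<le> x n) \<and> (\<forall>m\<in>M. (\<Sum>n\<in>N. a m n * x n) \<le> b m)"
    for x :: "'n \<Rightarrow> real"
  define obj where "obj x = (\<Sum>n\<in>N. c n * x n)" for x
  define v where "v = Sup (obj ` {x. feas x})"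
  have bdd: "bdd_above (obj ` {x. feas x})"
    using lp_weak_duality[of N _ M a b y0 c] y0
    by (auto simp: feas_def obj_def intro!: bdd_aboveI2[where M = "\<Sum>m\<in>M. b m * y0 m"])
  have feas_x0: "feas x0"
    using x0 by (simp add: feas_def)
  have v_upper: "obj x \<le> v" if "feas x" for x
    unfolding v_def using that bdd by (intro cSup_upper) auto
  obtain x where x: "feas x" "obj x > v - \<epsilon>"
    using less_cSup_iff[OF _ bdd, of "v - \<epsilon>"] feas_x0 \<open>0 < \<epsilon>\<close> by (auto simp: v_def)
  define a' where "a' m = case_option (- b m) (a m)" for m
  define c' where "c' = case_option (- v) c"
  have split: "(\<Sum>n\<in>insert None (Some ` N). f n) = f None + (\<Sum>n\<in>N. f (Some n))" for f :: "'n option \<Rightarrow> real"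
    using fin by (simp add: sum.reindex)
  obtain y where y: "\<And>m. m \<in> M \<Longrightarrow> 0 \<le> y m"
    "\<And>n. n \<in> insert None (Some ` N) \<Longrightarrow> c' n \<le> (\<Sum>m\<in>M. y m * a' m n)"
  proof (rule farkas_nonneg[of M "insert None (Some ` N)" a' c'])
    fix z :: "'n option \<Rightarrow> real"
    assume "\<And>n. n \<in> insert None (Some ` N) \<Longrightarrow> 0 \<le> z n"
      and "\<And>m. m \<in> M \<Longrightarrow> (\<Sum>n\<in>insert None (Some ` N). a' m n * z n) \<le> 0"
    then have z: "\<And>n. n \<in> N \<Longrightarrow> 0 \<le> z (Some n)" "0 \<le> z None"
      and az: "\<And>m. m \<in> M \<Longrightarrow> (\<Sum>n\<in>N. a m n * z (Some n)) \<le> b m * z None"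
      unfolding split by (auto simp: a'_def)
    have "obj (\<lambda>n. z (Some n)) \<le> v * z None"
    proof (cases "z None = 0")
      case False
      then have t: "z None > 0" using z by simp
      have "feas (\<lambda>n. z (Some n) / z None)"
        using z az t by (auto simp: feas_def sum_divide_distrib[symmetric] pos_divide_le_eq)
      from v_upper[OF this] show ?thesis
        using t by (simp add: obj_def sum_divide_distrib[symmetric] pos_divide_le_eq)
    next
      case True
      \<comment> \<open>Then \<open>z\<close> is a recession direction of the feasible set, and the value is bounded along it.\<close>
      have "obj x0 + s * obj (\<lambda>n. z (Some n)) \<le> v" if "s \<ge> 0" for s
      proof -
        have "feas (\<lambda>n. x0 n + s * z (Some n))"
          unfolding feas_def
        proof (intro conjI ballI)
          show "0 \<le> x0 n + s * z (Some n)" if "n \<in> N" for n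
            using x0 z that \<open>s \<ge> 0\<close> by simp
          show "(\<Sum>n\<in>N. a m n * (x0 n + s * z (Some n))) \<le> b m" if "m \<in> M" for m
          proof -
            have "(\<Sum>n\<in>N. a m n * (x0 n + s * z (Some n))) =
                (\<Sum>n\<in>N. a m n * x0 n) + s * (\<Sum>n\<in>N. a m n * z (Some n))"
              by (simp add: sum.distrib sum_distrib_left algebra_simps)
            also have "\<dots> \<le> b m + s * 0"
              using az[OF that] x0(2)[OF that] True \<open>s \<ge> 0\<close> by (intro add_mono mult_left_mono) auto
            finally show ?thesis by simp
          qed
        qed
        from v_upper[OF this] show ?thesis
          by (simp add: obj_def sum.distrib sum_distrib_left algebra_simps)
      qed
      note ray = this
      have "obj (\<lambda>n. z (Some n)) \<le> 0"
      proof (rule ccontr)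
        assume "\<not> ?thesis"
        then have pos: "obj (\<lambda>n. z (Some n)) > 0" by simp
        have "obj x0 + ((v - obj x0 + 1) / obj (\<lambda>n. z (Some n))) * obj (\<lambda>n. z (Some n)) \<le> v"
          using pos v_upper[OF feas_x0] by (intro ray) auto
        with pos show False by simp
      qed
      with True show ?thesis by simp
    qed
    then show "(\<Sum>n\<in>insert None (Some ` N). c' n * z n) \<le> 0"
      unfolding split by (simp add: c'_def obj_def)
  qed (use fin in auto)
  have "(\<Sum>m\<in>M. b m * y m) \<le> v"
    using y(2)[of None] by (simp add: c'_def a'_def sum_negf mult.commute)
  moreover have "c n \<le> (\<Sum>m\<in>M. y m * a m n)" if "n \<in> N" for n
    using y(2)[of "Some n"] that by (simp add: c'_def a'_def)
  ultimately show thesis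
    using x y(1) by (intro that[of x y]) (auto simp: feas_def obj_def)
qed

text \<open>
  A slack \<open>\<alpha>\<close> in the dual constraints prices every unit of primal activity at \<open>\<alpha>\<close>: weak duality for
  the program with \<open>c + \<alpha>\<close> in place of \<open>c\<close> gives \<open>\<alpha> * sum x \<le> b y0 - c x\<close>. The same holds with the
  two sides exchanged. This is how strict feasibility bounds the near-optimal solutions.
\<close>

lemma lp_near_duality_bounded:
  fixes a :: "'m \<Rightarrow> 'n \<Rightarrow> real" and b :: "'m \<Rightarrow> real" and c :: "'n \<Rightarrow> real"
  assumes fin: "finite M" "finite N" and "0 \<le> \<alpha>" "0 < \<epsilon>"
    and x0: "\<And>n. n \<in> N \<Longrightarrow> 0 \<le> x0 n" "\<And>m. m \<in> M \<Longrightarrow> (\<Sum>n\<in>N. a m n * x0 n) + \<alpha> \<le> b m"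
    and y0: "\<And>m. m \<in> M \<Longrightarrow> 0 \<le> y0 m" "\<And>n. n \<in> N \<Longrightarrow> c n + \<alpha> \<le> (\<Sum>m\<in>M. y0 m * a m n)"
  defines "gap \<equiv> (\<Sum>m\<in>M. b m * y0 m) - (\<Sum>n\<in>N. c n * x0 n)"
  obtains x y where
    "\<And>n. n \<in> N \<Longrightarrow> 0 \<le> x n" "\<And>m. m \<in> M \<Longrightarrow> (\<Sum>n\<in>N. a m n * x n) \<le> b m"
    "\<And>m. m \<in> M \<Longrightarrow> 0 \<le> y m" "\<And>n. n \<in> N \<Longrightarrow> c n \<le> (\<Sum>m\<in>M. y m * a m n)"
    "(\<Sum>m\<in>M. b m * y m) \<le> (\<Sum>n\<in>N. c n * x n) + \<epsilon>"
    "\<alpha> * (\<Sum>n\<in>N. x n) \<le> gap + \<epsilon>" "\<alpha> * (\<Sum>m\<in>M. y m) \<le> gap + \<epsilon>"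
proof -
  have x0': "(\<Sum>n\<in>N. a m n * x0 n) \<le> b m" if "m \<in> M" for m
    using x0(2)[OF that] \<open>0 \<le> \<alpha>\<close> by simp
  have y0': "c n \<le> (\<Sum>m\<in>M. y0 m * a m n)" if "n \<in> N" for n
    using y0(2)[OF that] \<open>0 \<le> \<alpha>\<close> by simp
  show thesis
  proof (rule lp_near_duality[of M N x0 a b y0 c \<epsilon>, OF fin x0(1) x0' y0(1) y0' \<open>0 < \<epsilon>\<close>])
    fix x y
    assume x: "\<And>n. n \<in> N \<Longrightarrow> 0 \<le> x n" "\<And>m. m \<in> M \<Longrightarrow> (\<Sum>n\<in>N. a m n * x n) \<le> b m"
    and y: "\<And>m. m \<in> M \<Longrightarrow> 0 \<le> y m" "\<And>n. n \<in> N \<Longrightarrow> c n \<le> (\<Sum>m\<in>M. y m * a m n)"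
    and near: "(\<Sum>m\<in>M. b m * y m) \<le> (\<Sum>n\<in>N. c n * x n) + \<epsilon>"
    have "(\<Sum>n\<in>N. (c n + \<alpha>) * x n) \<le> (\<Sum>m\<in>M. b m * y0 m)"
      by (rule lp_weak_duality[of N x M a b y0]) (use x y0 in auto)
    then have 1: "\<alpha> * (\<Sum>n\<in>N. x n) \<le> (\<Sum>m\<in>M. b m * y0 m) - (\<Sum>n\<in>N. c n * x n)"
      by (simp add: algebra_simps sum.distrib sum_distrib_left)
    have "(\<Sum>n\<in>N. c n * x0 n) \<le> (\<Sum>m\<in>M. (b m - \<alpha>) * y m)"
      by (rule lp_weak_duality[of N x0 M a _ y]) (use x0 y in \<open>auto simp: le_diff_eq\<close>)
    then have 2: "\<alpha> * (\<Sum>m\<in>M. y m) \<le> (\<Sum>m\<in>M. b m * y m) - (\<Sum>n\<in>N. c n * x0 n)"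
      by (simp add: algebra_simps sum_subtractf sum_distrib_left)
    have "\<alpha> * (\<Sum>n\<in>N. x n) \<ge> 0" "\<alpha> * (\<Sum>m\<in>M. y m) \<ge> 0"
      using x y \<open>0 \<le> \<alpha>\<close> by (auto intro!: mult_nonneg_nonneg sum_nonneg)
    with 1 2 near show thesis
      by (intro that[OF x y near]) (auto simp: gap_def)
  qed
qed

section \<open>Stieltjes integrals and weak duality\<close>

text \<open>
  Both sides are the mass that the product measure gives to \<open>{(s, t). s + t \<le> r}\<close>.
\<close>

lemma cdf_convolution_commute:
  assumes "finite_borel_measure M" "finite_borel_measure N"
  shows "(LINT t|M. cdf N (r - t)) = (LINT t|N. cdf M (r - t))"
proof -
  interpret M: finite_borel_measure M by fact
  interpret N: finite_borel_measure N by fact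
  interpret MN: pair_sigma_finite M N ..
  have sets[measurable_cong]: "sets M = sets borel" "sets N = sets borel"
    using M.M_is_borel N.M_is_borel by auto
  define f :: "real \<Rightarrow> real \<Rightarrow> real" where "f s t = indicator {..r} (s + t)" for s t
  have f: "f s t = indicator {..r - s} t" "f s t = indicator {..r - t} s" for s t
    by (auto simp: f_def indicator_def)
  interpret P: finite_measure "M \<Otimes>\<^sub>M N"
    by (rule finite_measure_pair_measure) unfold_locales
  have "case_prod f \<in> borel_measurable (M \<Otimes>\<^sub>M N)"
    unfolding f_def by measurable
  then have "integrable (M \<Otimes>\<^sub>M N) (case_prod f)"
    by (rule P.integrable_const_bound[where B = 1, rotated]) (auto simp: f_def indicator_def)
  from MN.Fubini_integral[OF this]
  have "(LINT t|N. LINT s|M. f s t) = (LINT s|M. LINT t|N. f s t)" .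
  moreover have "(LINT s|M. f s t) = cdf M (r - t)" for t
    unfolding f(2) cdf_def by (simp add: M.borel_UNIV)
  moreover have "(LINT t|N. f s t) = cdf N (r - s)" for s
    unfolding f(1) cdf_def by (simp add: N.borel_UNIV)
  ultimately show ?thesis by simp
qed

text \<open>
  One component of an admissible function, with the measure that it induces.
\<close>

locale control =
  fixes T :: real and u :: "real \<Rightarrow> real"
  assumes T_pos: "0 < T"
    and nonneg: "t \<in> {0..T} \<Longrightarrow> 0 \<le> u t"
    and mono: "mono_on {0..T} u"
    and right_cont: "t \<in> {0..<T} \<Longrightarrow> continuous (at_right t) u"
begin

abbreviation "\<mu> \<equiv> interval_measure (dist_fun T u)"

lemma dist_fun_mono: "x \<le> y \<Longrightarrow> dist_fun T u x \<le> dist_fun T u y"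
  using T_pos by (auto simp: dist_fun_def intro!: nonneg mono_onD[OF mono])

lemma dist_fun_right_cont: "continuous (at_right t) (dist_fun T u)"
proof -
  consider "t < 0" | "0 \<le> t" "t < T" | "T \<le> t" by linarith
  then show ?thesis
  proof cases
    case 1
    then have "\<forall>\<^sub>F x in at_right t. dist_fun T u x = 0"
      by (auto simp: eventually_at_right_field dist_fun_def intro: exI[of _ 0])
    then show ?thesis
      using 1 by (simp add: continuous_within dist_fun_def tendsto_eventually)
  next
    case 2
    then have "\<forall>\<^sub>F x in at_right t. u x = dist_fun T u x"
      by (auto simp: eventually_at_right_field dist_fun_def intro!: exI[of _ T])
    moreover have "(u \<longlongrightarrow> dist_fun T u t) (at_right t)"
      using right_cont[of t] 2 by (simp add: continuous_within dist_fun_def)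
    ultimately show ?thesis
      unfolding continuous_within by (rule Lim_transform_eventually[rotated])
  next
    case 3
    then have "\<forall>\<^sub>F x in at_right t. dist_fun T u x = dist_fun T u t"
      using T_pos by (auto simp: eventually_at_right_field dist_fun_def min_def intro!: exI[of _ "t + 1"])
    then show ?thesis
      by (simp add: continuous_within tendsto_eventually)
  qed
qed

lemma dist_fun_at_bot: "(dist_fun T u \<longlongrightarrow> 0) at_bot"
  by (rule tendsto_eventually) (auto simp: eventually_at_bot_linorder dist_fun_def intro!: exI[of _ "- 1"])

lemma dist_fun_at_top: "(dist_fun T u \<longlongrightarrow> u T) at_top"
  using T_pos
  by (intro tendsto_eventually) (auto simp: eventually_at_top_linorder dist_fun_def intro!: exI[of _ T])

lemma finite_borel_measure_\<mu>: "finite_borel_measure \<mu>"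
  using dist_fun_mono dist_fun_right_cont dist_fun_at_bot dist_fun_at_top
  by (rule finite_borel_measure_interval_measure) (use nonneg T_pos in auto)

sublocale \<mu>: finite_borel_measure \<mu>
  by (rule finite_borel_measure_\<mu>)

lemma cdf_\<mu>: "cdf \<mu> = dist_fun T u"
  using dist_fun_mono dist_fun_right_cont dist_fun_at_bot by (rule cdf_interval_measure)

text \<open>
  The mass before 0 vanishes as a countable union of half-lines on which the distribution function is
  0; the mass after \<open>T\<close> vanishes because the distribution function attains its limit \<open>u T\<close> at \<open>T\<close>.
\<close>

lemma AE_support: "AE t in \<mu>. t \<in> {0..T}"
proof -
  have UN: "{..<0} = (\<Union>n. {..- 1 / real (Suc n)})"
  proof (intro equalityI subsetI)
    fix x :: real assume "x \<in> {..<0}"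
    then obtain n where "inverse (real (Suc n)) < - x"
      using reals_Archimedean[of "- x"] by auto
    then show "x \<in> (\<Union>n. {..- 1 / real (Suc n)})"
      by (intro UN_I[of n]) (auto simp: inverse_eq_divide)
  next
    fix x assume "x \<in> (\<Union>n. {..- 1 / real (Suc n)})"
    then obtain n where "x \<le> - 1 / real (Suc n)" by auto
    also have "\<dots> < 0" by simp
    finally show "x \<in> {..<0}" by simp
  qed
  have "emeasure \<mu> {..- 1 / real (Suc n)} = 0" for n
    using cdf_\<mu> by (simp add: \<mu>.emeasure_eq_measure cdf_def dist_fun_def fun_eq_iff)
  then have left: "{..<0} \<in> null_sets \<mu>"
    unfolding UN by (intro null_sets_UN) (auto simp: null_sets_def)
  have "measure \<mu> UNIV = u T"
    using interval_measure_UNIV[OF dist_fun_mono dist_fun_right_cont dist_fun_at_bot dist_fun_at_top] nonneg T_pos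
    by (simp add: measure_def)
  moreover have "measure \<mu> {..T} = u T"
    using cdf_\<mu> T_pos by (simp add: cdf_def dist_fun_def fun_eq_iff)
  moreover have "measure \<mu> {T<..} = measure \<mu> UNIV - measure \<mu> {..T}"
    using \<mu>.finite_measure_compl[of "{..T}"] by (simp add: Compl_eq_Diff_UNIV[symmetric])
  ultimately have "{T<..} \<in> null_sets \<mu>"
    by (auto simp: null_sets_def \<mu>.emeasure_eq_measure)
  with left show ?thesis
    by (intro AE_I'[of "{..<0} \<union> {T<..}"]) auto
qed

lemma stieltjes_integral_eq:
  "stieltjes_integral T f u = (LINT t|\<mu>. f t)" if "f \<in> borel_measurable borel"
  unfolding stieltjes_integral_def set_lebesgue_integral_def
proof (rule integral_cong_AE)
  show "AE t in \<mu>. indicat_real {0..T} t *\<^sub>R f t = f t"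
    using AE_support by eventually_elim simp
qed (use that in measurable)

lemma integrable_bounded:
  fixes f :: "real \<Rightarrow> real"
  assumes "f \<in> borel_measurable borel" "\<And>t. t \<in> {0..T} \<Longrightarrow> \<bar>f t\<bar> \<le> B"
  shows "integrable \<mu> f"
proof (rule \<mu>.integrable_const_bound)
  show "AE t in \<mu>. norm (f t) \<le> B"
    using AE_support by eventually_elim (use assms in auto)
qed (use assms in measurable)

lemma borel_measurable_dist_fun [measurable]: "dist_fun T u \<in> borel_measurable borel"
  by (intro borel_measurable_mono monoI dist_fun_mono)

lemma dist_fun_bound: "\<bar>dist_fun T u t\<bar> \<le> u T"
  using T_pos dist_fun_mono[of "-1" t] dist_fun_mono[of t "max t T"]
  by (auto simp: dist_fun_def split: if_splits)

lemma stieltjes_integral_const: "stieltjes_integral T (\<lambda>_. g) u = g * u T"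
  using interval_measure_UNIV[OF dist_fun_mono dist_fun_right_cont dist_fun_at_bot dist_fun_at_top] nonneg T_pos
  by (simp add: stieltjes_integral_eq measure_def)

text \<open>
  Integration by parts, obtained from the symmetry of the convolution: the remaining time \<open>T - t\<close> is
  the distribution function of Lebesgue measure on \<open>[0,T]\<close>, evaluated at \<open>T - t\<close>.
\<close>

lemma stieltjes_integral_remaining_time:
  "stieltjes_integral T (\<lambda>t. T - t) u = (LINT t:{0..T}|lborel. u t)"
proof -
  define L where "L = density lborel (\<lambda>t. ennreal (indicator {0..T} t))"
  have sets_L [measurable_cong]: "sets L = sets borel" and space_L: "space L = UNIV"
    by (simp_all add: L_def)
  have em_L: "emeasure L X = emeasure lborel ({0..T} \<inter> X)" if "X \<in> sets borel" for X
    using that by (simp add: L_def emeasure_density ennreal_indicator indicator_inter_arith[symmetric])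
  have L: "finite_borel_measure L"
    by (intro finite_borel_measure.intro finite_measureI finite_borel_measure_axioms.intro)
      (use T_pos in \<open>auto simp: em_L space_L sets_L\<close>)
  have cdf_L: "cdf L (T - t) = T - t" if "t \<in> {0..T}" for t
  proof -
    have "{0..T} \<inter> {..T - t} = {0..T - t}" using that by auto
    then show ?thesis
      using that by (simp add: cdf_def measure_def em_L)
  qed
  have "stieltjes_integral T (\<lambda>t. T - t) u = (LINT t|\<mu>. T - t)"
    by (rule stieltjes_integral_eq) measurable
  also have "\<dots> = (LINT t|\<mu>. cdf L (T - t))"
  proof (rule integral_cong_AE)
    show "AE t in \<mu>. T - t = cdf L (T - t)"
      using AE_support by eventually_elim (simp add: cdf_L)
    have "cdf L \<in> borel_measurable borel"
      by (intro borel_measurable_mono monoI finite_borel_measure.cdf_nondecreasing[OF L])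
    then show "(\<lambda>t. cdf L (T - t)) \<in> borel_measurable \<mu>" by measurable
  qed measurable
  also have "\<dots> = (LINT t|L. dist_fun T u (T - t))"
    using cdf_convolution_commute[OF finite_borel_measure_\<mu> L] by (simp add: cdf_\<mu>)
  also have "\<dots> = (LINT t|lborel. indicator {0..T} t * dist_fun T u (T - t))"
    by (simp add: L_def integral_real_density)
  also have "\<dots> = (LINT t|lborel. indicator {0..T} (T - t) * dist_fun T u (T - (T - t)))"
    by (subst lborel_integral_real_affine[where c = "- 1" and t = T]) auto
  also have "\<dots> = (LINT t:{0..T}|lborel. u t)"
    unfolding set_lebesgue_integral_def
    by (intro Bochner_Integration.integral_cong) (auto simp: indicator_def dist_fun_def)
  finally show ?thesis .
qed

lemma stieltjes_integral_affine:
  "stieltjes_integral T (\<lambda>t. g + (T - t) * k) u = g * u T + k * (LINT t:{0..T}|lborel. u t)"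
proof -
  have int: "integrable \<mu> (\<lambda>t. T - t)"
    by (rule integrable_bounded[where B = T]) auto
  have "stieltjes_integral T (\<lambda>t. g + (T - t) * k) u = (LINT t|\<mu>. g + (T - t) * k)"
    by (rule stieltjes_integral_eq) measurable
  also have "\<dots> = (LINT t|\<mu>. g) + (LINT t|\<mu>. T - t) * k"
    using int by simp
  also have "(LINT t|\<mu>. g) = g * u T"
    using stieltjes_integral_const[of g] by (simp add: stieltjes_integral_eq)
  also have "(LINT t|\<mu>. T - t) = (LINT t:{0..T}|lborel. u t)"
    using stieltjes_integral_remaining_time by (simp add: stieltjes_integral_eq)
  finally show ?thesis by simp
qed

end

lemma control_component:
  assumes "0 < T" "admissible T U"
  shows "control T (\<lambda>t. U t $ i)"
proof
  show "0 < T" by fact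
  show "0 \<le> U t $ i" if "t \<in> {0..T}" for t
    using assms that by (auto simp: admissible_def less_eq_vec_def)
  show "mono_on {0..T} (\<lambda>t. U t $ i)"
    using assms by (auto simp: admissible_def mono_on_def less_eq_vec_def)
  show "continuous (at_right t) (\<lambda>t. U t $ i)" if "t \<in> {0..<T}" for t
    using assms that by (auto simp: admissible_def continuous_within intro: tendsto_intros)
qed

lemma stieltjes_convolution_commute:
  assumes "control T u" "control T v"
  shows "stieltjes_integral T (\<lambda>t. dist_fun T v (T - t)) u =
    stieltjes_integral T (\<lambda>t. dist_fun T u (T - t)) v"
proof -
  interpret u: control T u by fact
  interpret v: control T v by fact
  show ?thesis
    using cdf_convolution_commute[OF u.finite_borel_measure_\<mu> v.finite_borel_measure_\<mu>, of T]
    by (simp add: u.stieltjes_integral_eq v.stieltjes_integral_eq u.cdf_\<mu> v.cdf_\<mu>)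
qed

text \<open>
  The objective of either problem after integration by parts. It involves only the values of \<open>U\<close>, not
  the measure, so that it converges along uniformly bounded controls that converge pointwise
  almost everywhere and at \<open>T\<close>.
\<close>

definition affine_value :: "real \<Rightarrow> real^'i \<Rightarrow> real^'i \<Rightarrow> (real \<Rightarrow> real^'i) \<Rightarrow> real" where
  "affine_value T \<gamma> c U = (\<Sum>i\<in>UNIV. \<gamma> $ i * U T $ i + c $ i * (LINT t:{0..T}|lborel. U t $ i))"

lemma mclp_objective_eq_affine_value:
  assumes "0 < T" "admissible T U"
  shows "mclp_objective T \<gamma> c U = affine_value T \<gamma> c U"
  using control.stieltjes_integral_affine[OF control_component[OF assms]]
  by (simp add: mclp_objective_def vec_stieltjes_integral_def affine_value_def)

lemma mclp_dual_objective_eq_affine_value: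
  assumes "0 < T" "admissible T P"
  shows "mclp_dual_objective T \<beta> b P = affine_value T \<beta> b P"
  using mclp_objective_eq_affine_value[OF assms]
  by (simp add: mclp_objective_def mclp_dual_objective_def)

text \<open>
  Replacing \<open>\<gamma> + (T - t) c\<close> by the larger \<open>A\<^sup>T P (T - t)\<close> turns the primal objective into a convolution
  of \<open>U\<close> and \<open>P\<close>, which is symmetric; on the other side it is bounded by the dual objective.
\<close>

lemma mclp_weak_duality:
  fixes A :: "real^'j^'k"
  assumes T: "0 < T" and U: "mclp_feasible T A \<beta> b U" and P: "mclp_dual_feasible T A \<gamma> c P"
  shows "mclp_objective T \<gamma> c U \<le> mclp_dual_objective T \<beta> b P"
proof -
  have adm: "admissible T U" "admissible T P"
    using U P by (auto simp: mclp_feasible_def mclp_dual_feasible_def)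
  define u where "u j t = U t $ j" for j t
  define p where "p k t = P t $ k" for k t
  have u: "control T (u j)" and p: "control T (p k)" for j k
    unfolding u_def p_def using T adm by (auto intro: control_component)
  have meas [measurable]: "dist_fun T (u j) \<in> borel_measurable borel"
      "dist_fun T (p k) \<in> borel_measurable borel" for j k
    using control.borel_measurable_dist_fun u p by auto
  have int_u: "integrable (interval_measure (dist_fun T (u j))) (\<lambda>t. dist_fun T (p k) (T - t))"
    and int_p: "integrable (interval_measure (dist_fun T (p k))) (\<lambda>t. dist_fun T (u j) (T - t))" for j k
    by (auto intro!: control.integrable_bounded[OF u, where B = "p k T"]
      control.integrable_bounded[OF p, where B = "u j T"] control.dist_fun_bound u p)
  have int_affine: "integrable (interval_measure (dist_fun T v)) (\<lambda>t. g + (T - t) * r)"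
    if "control T v" for v g r
  proof (rule control.integrable_bounded[OF that])
    fix t assume "t \<in> {0..T}"
    then have "\<bar>T - t\<bar> * \<bar>r\<bar> \<le> T * \<bar>r\<bar>" by (intro mult_right_mono) auto
    then show "\<bar>g + (T - t) * r\<bar> \<le> \<bar>g\<bar> + T * \<bar>r\<bar>"
      using abs_triangle_ineq[of g "(T - t) * r"] by (simp add: abs_mult)
  qed measurable
  have "mclp_objective T \<gamma> c U = (\<Sum>j\<in>UNIV. LINT t|interval_measure (dist_fun T (u j)). \<gamma> $ j + (T - t) * c $ j)"
    by (simp add: mclp_objective_def vec_stieltjes_integral_def u_def[symmetric] control.stieltjes_integral_eq[OF u])
  also have "\<dots> \<le> (\<Sum>j\<in>UNIV. LINT t|interval_measure (dist_fun T (u j)). (\<Sum>k\<in>UNIV. A $ k $ j * dist_fun T (p k) (T - t)))"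
  proof (intro sum_mono integral_mono_AE)
    fix j
    show "AE t in interval_measure (dist_fun T (u j)). \<gamma> $ j + (T - t) * c $ j \<le> (\<Sum>k\<in>UNIV. A $ k $ j * dist_fun T (p k) (T - t))"
      using control.AE_support[OF u]
    proof eventually_elim
      fix t assume t: "t \<in> {0..T}"
      then have "\<gamma> + (T - t) *\<^sub>R c \<le> transpose A *v P (T - t)"
        using P by (auto simp: mclp_dual_feasible_def)
      with t show "\<gamma> $ j + (T - t) * c $ j \<le> (\<Sum>k\<in>UNIV. A $ k $ j * dist_fun T (p k) (T - t))"
        by (simp add: less_eq_vec_def matrix_vector_mult_def transpose_def dist_fun_def p_def)
    qed
  qed (auto intro!: int_affine u int_u)
  also have "\<dots> = (\<Sum>j\<in>UNIV. \<Sum>k\<in>UNIV. A $ k $ j * (LINT t|interval_measure (dist_fun T (u j)). dist_fun T (p k) (T - t)))"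
    using int_u by simp
  also have "\<dots> = (\<Sum>j\<in>UNIV. \<Sum>k\<in>UNIV. A $ k $ j * (LINT t|interval_measure (dist_fun T (p k)). dist_fun T (u j) (T - t)))"
    using stieltjes_convolution_commute[OF u p]
    by (simp add: control.stieltjes_integral_eq[OF u] control.stieltjes_integral_eq[OF p])
  also have "\<dots> = (\<Sum>k\<in>UNIV. LINT t|interval_measure (dist_fun T (p k)). (\<Sum>j\<in>UNIV. A $ k $ j * dist_fun T (u j) (T - t)))"
    using int_p by (subst sum.swap) simp
  also have "\<dots> \<le> (\<Sum>k\<in>UNIV. LINT t|interval_measure (dist_fun T (p k)). \<beta> $ k + (T - t) * b $ k)"
  proof (intro sum_mono integral_mono_AE)
    fix k
    show "AE t in interval_measure (dist_fun T (p k)). (\<Sum>j\<in>UNIV. A $ k $ j * dist_fun T (u j) (T - t)) \<le> \<beta> $ k + (T - t) * b $ k"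
      using control.AE_support[OF p]
    proof eventually_elim
      fix t assume t: "t \<in> {0..T}"
      then have "A *v U (T - t) \<le> \<beta> + (T - t) *\<^sub>R b"
        using U by (auto simp: mclp_feasible_def)
      with t show "(\<Sum>j\<in>UNIV. A $ k $ j * dist_fun T (u j) (T - t)) \<le> \<beta> $ k + (T - t) * b $ k"
        by (simp add: less_eq_vec_def matrix_vector_mult_def dist_fun_def u_def)
    qed
  qed (auto intro!: int_affine p int_p)
  also have "\<dots> = mclp_dual_objective T \<beta> b P"
    by (simp add: mclp_dual_objective_def vec_stieltjes_integral_def p_def[symmetric] control.stieltjes_integral_eq[OF p])
  finally show ?thesis .
qed

section \<open>The discretised problems\<close>

definition grid :: "real \<Rightarrow> nat \<Rightarrow> nat \<Rightarrow> real" where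
  "grid T n i = T * real i / real n"

definition step_fun :: "real \<Rightarrow> nat \<Rightarrow> (nat \<Rightarrow> real^'i) \<Rightarrow> real \<Rightarrow> real^'i" where
  "step_fun T n u t = (\<Sum>i\<le>n. if grid T n i \<le> t then u i else 0)"

lemma grid_mono: "0 \<le> T \<Longrightarrow> i \<le> l \<Longrightarrow> grid T n i \<le> grid T n l"
  by (simp add: grid_def divide_right_mono mult_left_mono)

lemma grid_bounds: "0 \<le> T \<Longrightarrow> i \<le> n \<Longrightarrow> grid T n i \<in> {0..T}"
  by (cases "n = 0") (auto simp: grid_def divide_le_eq mult_left_mono)

lemma grid_reverse: "0 < n \<Longrightarrow> i \<le> n \<Longrightarrow> grid T n (n - i) = T - grid T n i"
  by (simp add: grid_def field_simps of_nat_diff)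

lemma step_fun_component: "step_fun T n u t $ j = (\<Sum>i\<le>n. if grid T n i \<le> t then u i $ j else 0)"
  by (simp add: step_fun_def if_distrib[of "\<lambda>v. v $ j"] cong: if_cong)

lemma mono_step_fun:
  assumes "\<And>i. i \<le> n \<Longrightarrow> 0 \<le> u i $ j"
  shows "mono (\<lambda>t. step_fun T n u t $ j)"
  unfolding step_fun_component using assms by (intro monoI sum_mono) auto

lemma right_cont_step_fun: "continuous (at_right t) (\<lambda>t. step_fun T n u t $ j)"
proof -
  have "((\<lambda>t. if g \<le> t then r else 0) \<longlongrightarrow> (if g \<le> t then r else 0)) (at_right t)" for g r :: real
  proof (rule tendsto_eventually)
    show "\<forall>\<^sub>F x in at_right t. (if g \<le> x then r else 0) = (if g \<le> t then r else 0)"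
      unfolding eventually_at_right_field
      by (rule exI[of _ "if g \<le> t then t + 1 else g"]) auto
  qed
  then show ?thesis
    unfolding continuous_within step_fun_component by (intro tendsto_sum)
qed

lemma step_fun_bounds:
  fixes u :: "nat \<Rightarrow> real^'i"
  assumes "\<And>i j. i \<le> n \<Longrightarrow> 0 \<le> u i $ j" and "(\<Sum>i\<le>n. \<Sum>j\<in>UNIV. u i $ j) \<le> C"
  shows "0 \<le> step_fun T n u t $ j" "step_fun T n u t $ j \<le> C"
proof -
  show "0 \<le> step_fun T n u t $ j"
    unfolding step_fun_component using assms by (auto intro!: sum_nonneg)
  have "step_fun T n u t $ j \<le> (\<Sum>i\<le>n. u i $ j)"
    unfolding step_fun_component using assms by (intro sum_mono) auto
  also have "\<dots> \<le> (\<Sum>i\<le>n. \<Sum>j\<in>UNIV. u i $ j)"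
    using assms by (intro sum_mono member_le_sum) auto
  finally show "step_fun T n u t $ j \<le> C"
    using assms by simp
qed

lemma step_fun_after: "0 \<le> T \<Longrightarrow> T \<le> t \<Longrightarrow> step_fun T n u t = (\<Sum>i\<le>n. u i)"
  unfolding step_fun_def by (intro sum.cong) (use grid_bounds[of T _ n] in \<open>auto simp: not_le\<close>, force)

text \<open>
  The index \<open>i\<close> is that of the last grid point not after \<open>t\<close>.
\<close>

lemma step_fun_eq_partial_sum:
  assumes "0 < T" "0 < n" "0 \<le> t" "t \<le> T"
  obtains i where "i \<le> n" "step_fun T n u t = (\<Sum>l\<le>i. u l)" "grid T n i \<le> t" "t \<le> grid T n i + T / real n"
proof -
  define i where "i = nat \<lfloor>t * real n / T\<rfloor>"
  have le: "l \<le> i \<longleftrightarrow> grid T n l \<le> t" for l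
  proof -
    have "l \<le> i \<longleftrightarrow> real l \<le> t * real n / T"
      using assms by (simp add: i_def le_nat_floor le_nat_iff le_floor_iff)
    also have "\<dots> \<longleftrightarrow> grid T n l \<le> t"
      using assms by (simp add: grid_def field_simps)
    finally show ?thesis .
  qed
  have "t * real n / T \<le> real n"
    using assms by (simp add: divide_le_eq mult.commute)
  then have "i \<le> n"
    unfolding i_def by (simp add: floor_le_iff nat_le_iff)
  moreover have "step_fun T n u t = (\<Sum>l\<le>i. u l)"
  proof -
    have "step_fun T n u t = (\<Sum>l\<in>{..n} \<inter> {l. l \<le> i}. u l)"
      unfolding step_fun_def le[symmetric] by (simp add: sum.inter_restrict)
    also have "{..n} \<inter> {l. l \<le> i} = {..i}"
      using \<open>i \<le> n\<close> by auto
    finally show ?thesis .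
  qed
  moreover have "grid T n i \<le> t"
    using le[of i] by simp
  moreover have "t \<le> grid T n i + T / real n"
    using le[of "Suc i"] by (simp add: grid_def add_divide_distrib distrib_left)
  ultimately show thesis by (rule that)
qed

lemma affine_value_step_fun:
  fixes u :: "nat \<Rightarrow> real^'i"
  assumes "0 < T"
  shows "affine_value T \<gamma> c (step_fun T n u) = (\<Sum>l\<le>n. (\<gamma> + (T - grid T n l) *\<^sub>R c) \<bullet> u l)"
proof -
  have int: "(LINT t:{0..T}|lborel. step_fun T n u t $ j) = (\<Sum>l\<le>n. (T - grid T n l) * u l $ j)" for j
  proof -
    have "(LINT t:{0..T}|lborel. step_fun T n u t $ j) =
        (LINT t|lborel. (\<Sum>l\<le>n. indicator {grid T n l..T} t * u l $ j))"
      unfolding set_lebesgue_integral_def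
    proof (intro Bochner_Integration.integral_cong refl)
      fix t
      show "indicat_real {0..T} t *\<^sub>R step_fun T n u t $ j = (\<Sum>l\<le>n. indicator {grid T n l..T} t * u l $ j)"
        unfolding step_fun_component scaleR_sum_right
        using grid_bounds[of T _ n] assms by (intro sum.cong) (auto simp: indicator_def, force)
    qed
    also have "\<dots> = (\<Sum>l\<le>n. (LINT t|lborel. indicator {grid T n l..T} t * u l $ j))"
      by (intro Bochner_Integration.integral_sum integrable_mult_left integrable_real_indicator)
        (auto simp: emeasure_lborel_Icc_eq)
    also have "\<dots> = (\<Sum>l\<le>n. (T - grid T n l) * u l $ j)"
      using grid_bounds[of T _ n] assms by (intro sum.cong) (auto simp: measure_def)
    finally show ?thesis .
  qed
  have "affine_value T \<gamma> c (step_fun T n u) =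
      (\<Sum>j\<in>UNIV. \<Sum>l\<le>n. (\<gamma> $ j + (T - grid T n l) * c $ j) * u l $ j)"
    unfolding affine_value_def int using assms
    by (simp add: step_fun_after sum_distrib_left sum.distrib sum_subtractf algebra_simps)
  then show ?thesis
    by (subst (asm) sum.swap) (simp add: inner_vec_def)
qed

text \<open>
  The jumps of the step function that agrees with \<open>V\<close> on the grid; this is how a feasible solution in
  continuous time yields one of the discretised problem.
\<close>

definition increment :: "real \<Rightarrow> nat \<Rightarrow> (real \<Rightarrow> real^'i) \<Rightarrow> nat \<Rightarrow> real^'i" where
  "increment T n V i = V (grid T n i) - (if i = 0 then 0 else V (grid T n (i - 1)))"

lemma sum_increment: "(\<Sum>l\<le>i. increment T n V l) = V (grid T n i)"
  by (induction i) (auto simp: increment_def)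

lemma increment_nonneg:
  assumes "0 < T" "admissible T V" "i \<le> n"
  shows "0 \<le> increment T n V i $ j"
proof -
  interpret control T "\<lambda>t. V t $ j" using assms by (intro control_component)
  show ?thesis
    using mono_onD[OF mono, of "grid T n (i - 1)" "grid T n i"] nonneg[of "grid T n i"] assms
      grid_bounds[of T i n] grid_bounds[of T "i - 1" n] grid_mono[of T "i - 1" i n]
    by (auto simp: increment_def)
qed

text \<open>
  The bound does not depend on \<open>n\<close>. It makes the bound on discrete near-optimal solutions uniform.
\<close>

lemma affine_increments_bound:
  fixes V :: "real \<Rightarrow> real^'i"
  assumes "0 < T" "0 < n" "admissible T V"
  shows "\<bar>\<Sum>l\<le>n. (\<gamma> + (T - grid T n l) *\<^sub>R c) \<bullet> increment T n V l\<bar> \<le>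
    (\<Sum>j\<in>UNIV. (\<bar>\<gamma> $ j\<bar> + T * \<bar>c $ j\<bar>) * V T $ j)"
proof -
  have coeff: "\<bar>\<gamma> $ j + (T - grid T n l) * c $ j\<bar> \<le> \<bar>\<gamma> $ j\<bar> + T * \<bar>c $ j\<bar>" if "l \<le> n" for l j
  proof -
    have "\<bar>(T - grid T n l) * c $ j\<bar> \<le> T * \<bar>c $ j\<bar>"
      using grid_bounds[of T l n] assms that by (auto simp: abs_mult intro!: mult_right_mono)
    then show ?thesis by linarith
  qed
  have "\<bar>\<Sum>l\<le>n. (\<gamma> + (T - grid T n l) *\<^sub>R c) \<bullet> increment T n V l\<bar>
      \<le> (\<Sum>l\<le>n. \<Sum>j\<in>UNIV. (\<bar>\<gamma> $ j\<bar> + T * \<bar>c $ j\<bar>) * increment T n V l $ j)"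
    unfolding inner_vec_def
    by (intro order_trans[OF sum_abs] sum_mono)
      (use coeff increment_nonneg[OF assms(1,3)] \<open>0 < T\<close> in \<open>auto simp: abs_mult intro!: mult_mono add_nonneg_nonneg\<close>)
  also have "\<dots> = (\<Sum>j\<in>UNIV. (\<bar>\<gamma> $ j\<bar> + T * \<bar>c $ j\<bar>) * (\<Sum>l\<le>n. increment T n V l) $ j)"
    by (subst sum.swap) (simp add: sum_distrib_left)
  finally show ?thesis
    using assms by (simp add: sum_increment grid_def)
qed

text \<open>
  If controls may jump only at grid points and the constraints are imposed only there, M-CLP becomes a
  finite linear program with a block lower triangular matrix. Its dual has a block upper triangular
  matrix, and numbering its blocks backwards, \<open>p i = q (n - i)\<close>, turns it into the same discretisation
  of M-CLP\<open>\<^sup>*\<close>, because the grid is symmetric under \<open>t \<mapsto> T - t\<close>. So the two discretised problems are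
  exactly dual to each other. Sampling \<open>U0\<close> and \<open>P0\<close> on the grid keeps their slack \<open>\<alpha>\<close>.
\<close>

lemma discrete_near_duality:
  fixes A :: "real^'j^'k" and \<beta> b :: "real^'k" and \<gamma> c :: "real^'j"
  assumes "0 < T" "0 < n" "0 < \<epsilon>" "0 \<le> \<alpha>"
    and U0: "admissible T U0" "\<And>t k. t \<in> {0..T} \<Longrightarrow> (A *v U0 t) $ k + \<alpha> \<le> \<beta> $ k + t * b $ k"
    and P0: "admissible T P0" "\<And>t j. t \<in> {0..T} \<Longrightarrow> \<gamma> $ j + t * c $ j + \<alpha> \<le> (transpose A *v P0 t) $ j"
  defines "gap \<equiv> (\<Sum>k\<in>UNIV. (\<bar>\<beta> $ k\<bar> + T * \<bar>b $ k\<bar>) * P0 T $ k) +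
    (\<Sum>j\<in>UNIV. (\<bar>\<gamma> $ j\<bar> + T * \<bar>c $ j\<bar>) * U0 T $ j)"
  obtains u p where
    "\<And>i j. i \<le> n \<Longrightarrow> 0 \<le> u i $ j" "\<And>i k. i \<le> n \<Longrightarrow> 0 \<le> p i $ k"
    "\<And>i k. i \<le> n \<Longrightarrow> (A *v (\<Sum>l\<le>i. u l)) $ k \<le> \<beta> $ k + grid T n i * b $ k"
    "\<And>i j. i \<le> n \<Longrightarrow> \<gamma> $ j + grid T n i * c $ j \<le> (transpose A *v (\<Sum>l\<le>i. p l)) $ j"
    "(\<Sum>l\<le>n. (\<beta> + (T - grid T n l) *\<^sub>R b) \<bullet> p l) \<le> (\<Sum>l\<le>n. (\<gamma> + (T - grid T n l) *\<^sub>R c) \<bullet> u l) + \<epsilon>"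
    "\<alpha> * (\<Sum>i\<le>n. \<Sum>j\<in>UNIV. u i $ j) \<le> gap + \<epsilon>" "\<alpha> * (\<Sum>i\<le>n. \<Sum>k\<in>UNIV. p i $ k) \<le> gap + \<epsilon>"
proof -
  define M where "M = {..n} \<times> (UNIV :: 'k set)"
  define N where "N = {..n} \<times> (UNIV :: 'j set)"
  define a :: "nat \<times> 'k \<Rightarrow> nat \<times> 'j \<Rightarrow> real" where "a = (\<lambda>(i, k) (l, j). if l \<le> i then A $ k $ j else 0 :: real)"
  define b' where "b' = (\<lambda>(i, k). \<beta> $ k + grid T n i * b $ k)"
  define c' where "c' = (\<lambda>(l, j). \<gamma> $ j + (T - grid T n l) * c $ j)"
  \<comment> \<open>Block indices \<open>i\<close> of the dual variables count backwards in time, hence the \<open>n - i\<close>.\<close>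
  define flat where "flat u = (\<lambda>(l, j). u l $ j)" for u :: "nat \<Rightarrow> real^'j"
  define flat_rev where "flat_rev p = (\<lambda>(i, k). p (n - i) $ k)" for p :: "nat \<Rightarrow> real^'k"
  have fin: "finite M" "finite N" by (auto simp: M_def N_def)
  have rev: "(\<Sum>i\<le>n. f (n - i)) = (\<Sum>i\<le>n. f i)" for f :: "nat \<Rightarrow> real"
    by (intro sum.reindex_bij_witness[of _ "\<lambda>i. n - i" "\<lambda>i. n - i"]) auto
  have primal_row: "(\<Sum>z\<in>N. a (i, k) z * flat u z) = (A *v (\<Sum>l\<le>i. u l)) $ k" if "i \<le> n" for i k u
  proof -
    have "(\<Sum>z\<in>N. a (i, k) z * flat u z) = (\<Sum>l\<le>n. \<Sum>j\<in>UNIV. if l \<le> i then A $ k $ j * u l $ j else 0)"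
      unfolding N_def sum.cartesian_product' by (intro sum.cong) (auto simp: a_def flat_def)
    also have "\<dots> = (\<Sum>l\<in>{..n} \<inter> {l. l \<le> i}. \<Sum>j\<in>UNIV. A $ k $ j * u l $ j)"
      by (subst sum.inter_restrict) (auto intro!: sum.cong)
    also have "{..n} \<inter> {l. l \<le> i} = {..i}"
      using that by auto
    finally show ?thesis
      by (subst (asm) sum.swap) (simp add: matrix_vector_mult_def sum_distrib_left)
  qed
  have dual_row: "(\<Sum>z\<in>M. flat_rev p z * a z (l, j)) = (transpose A *v (\<Sum>i\<le>n - l. p i)) $ j" if "l \<le> n" for l j p
  proof -
    have "(\<Sum>z\<in>M. flat_rev p z * a z (l, j)) = (\<Sum>i\<le>n. \<Sum>k\<in>UNIV. if l \<le> i then A $ k $ j * p (n - i) $ k else 0)"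
      unfolding M_def sum.cartesian_product' by (intro sum.cong) (auto simp: a_def flat_rev_def)
    also have "\<dots> = (\<Sum>i\<le>n. \<Sum>k\<in>UNIV. if l \<le> n - i then A $ k $ j * p i $ k else 0)"
      by (subst rev[symmetric]) (auto intro!: sum.cong)
    also have "\<dots> = (\<Sum>i\<in>{..n} \<inter> {i. l \<le> n - i}. \<Sum>k\<in>UNIV. A $ k $ j * p i $ k)"
      by (subst sum.inter_restrict) (auto intro!: sum.cong)
    also have "{..n} \<inter> {i. l \<le> n - i} = {..n - l}"
      using that by auto
    finally show ?thesis
      by (subst (asm) sum.swap) (simp add: matrix_vector_mult_def transpose_def sum_distrib_left)
  qed
  have primal_obj: "(\<Sum>z\<in>N. c' z * flat u z) = (\<Sum>l\<le>n. (\<gamma> + (T - grid T n l) *\<^sub>R c) \<bullet> u l)" for u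
    unfolding N_def sum.cartesian_product' by (simp add: c'_def flat_def inner_vec_def)
  have dual_obj: "(\<Sum>z\<in>M. b' z * flat_rev p z) = (\<Sum>l\<le>n. (\<beta> + (T - grid T n l) *\<^sub>R b) \<bullet> p l)" for p
  proof -
    have "(\<Sum>z\<in>M. b' z * flat_rev p z) = (\<Sum>i\<le>n. (\<beta> + grid T n i *\<^sub>R b) \<bullet> p (n - i))"
      unfolding M_def sum.cartesian_product' by (simp add: b'_def flat_rev_def inner_vec_def)
    also have "\<dots> = (\<Sum>i\<le>n. (\<beta> + grid T n (n - i) *\<^sub>R b) \<bullet> p i)"
      by (subst rev[symmetric]) (auto intro!: sum.cong)
    finally show ?thesis
      using \<open>0 < n\<close> by (simp add: grid_reverse)
  qed
  have sum_flat: "(\<Sum>z\<in>N. flat u z) = (\<Sum>i\<le>n. \<Sum>j\<in>UNIV. u i $ j)" for u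
    unfolding N_def sum.cartesian_product' by (simp add: flat_def)
  have sum_flat_rev: "(\<Sum>z\<in>M. flat_rev p z) = (\<Sum>i\<le>n. \<Sum>k\<in>UNIV. p i $ k)" for p
    unfolding M_def sum.cartesian_product'
    using rev[of "\<lambda>i. \<Sum>k\<in>UNIV. p i $ k"] by (simp add: flat_rev_def)
  have in_grid: "grid T n i \<in> {0..T}" if "i \<le> n" for i
    using \<open>0 < T\<close> that by (intro grid_bounds) auto
  obtain x y where xy: "\<And>z. z \<in> N \<Longrightarrow> 0 \<le> x z" "\<And>m. m \<in> M \<Longrightarrow> (\<Sum>z\<in>N. a m z * x z) \<le> b' m"
    "\<And>m. m \<in> M \<Longrightarrow> 0 \<le> y m" "\<And>z. z \<in> N \<Longrightarrow> c' z \<le> (\<Sum>m\<in>M. y m * a m z)"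
    "(\<Sum>m\<in>M. b' m * y m) \<le> (\<Sum>z\<in>N. c' z * x z) + \<epsilon>"
    and bound: "\<alpha> * (\<Sum>z\<in>N. x z) \<le> (\<Sum>m\<in>M. b' m * flat_rev (increment T n P0) m) - (\<Sum>z\<in>N. c' z * flat (increment T n U0) z) + \<epsilon>"
     "\<alpha> * (\<Sum>m\<in>M. y m) \<le> (\<Sum>m\<in>M. b' m * flat_rev (increment T n P0) m) - (\<Sum>z\<in>N. c' z * flat (increment T n U0) z) + \<epsilon>"
  proof (rule lp_near_duality_bounded[of M N \<alpha> \<epsilon> "flat (increment T n U0)" a b' "flat_rev (increment T n P0)" c'])
    show "0 \<le> flat (increment T n U0) z" if "z \<in> N" for z
      using that increment_nonneg[OF \<open>0 < T\<close> U0(1)] by (auto simp: flat_def N_def)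
    show "0 \<le> flat_rev (increment T n P0) z" if "z \<in> M" for z
      using that increment_nonneg[OF \<open>0 < T\<close> P0(1)] by (auto simp: flat_rev_def M_def)
    show "(\<Sum>z\<in>N. a m z * flat (increment T n U0) z) + \<alpha> \<le> b' m" if "m \<in> M" for m
      using that in_grid by (auto simp: M_def primal_row sum_increment b'_def intro!: U0(2))
    show "c' z + \<alpha> \<le> (\<Sum>m\<in>M. flat_rev (increment T n P0) m * a m z)" if "z \<in> N" for z
    proof -
      obtain l j where z: "z = (l, j)" "l \<le> n"
        using \<open>z \<in> N\<close> by (cases z) (auto simp: N_def)
      then have "T - grid T n l \<in> {0..T}" using in_grid[of l] by auto
      from P0(2)[OF this, of j] z \<open>0 < n\<close> show ?thesis
        by (simp add: dual_row sum_increment c'_def grid_reverse)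
    qed
  qed (use fin assms in auto)
  define u where "u i = (\<chi> j. x (i, j))" for i
  define p where "p i = (\<chi> k. y (n - i, k))" for i
  have x: "flat u z = x z" for z
    by (cases z) (simp add: flat_def u_def)
  have y: "flat_rev p z = y z" if "z \<in> M" for z
    using that by (auto simp: M_def flat_rev_def p_def)
  have gap: "(\<Sum>m\<in>M. b' m * flat_rev (increment T n P0) m) - (\<Sum>z\<in>N. c' z * flat (increment T n U0) z) \<le> gap"
    using affine_increments_bound[OF \<open>0 < T\<close> \<open>0 < n\<close> U0(1), of \<gamma> c]
      affine_increments_bound[OF \<open>0 < T\<close> \<open>0 < n\<close> P0(1), of \<beta> b]
    unfolding primal_obj dual_obj gap_def by linarith
  show thesis
  proof (rule that[of u p])
    show "0 \<le> u i $ j" if "i \<le> n" for i j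
      using xy(1) that by (auto simp: u_def N_def)
    show "0 \<le> p i $ k" if "i \<le> n" for i k
      using xy(3) that by (auto simp: p_def M_def)
    show "(A *v (\<Sum>l\<le>i. u l)) $ k \<le> \<beta> $ k + grid T n i * b $ k" if "i \<le> n" for i k
      using xy(2)[of "(i, k)"] primal_row[OF that, of k u] that by (simp add: x M_def b'_def)
    show "\<gamma> $ j + grid T n i * c $ j \<le> (transpose A *v (\<Sum>l\<le>i. p l)) $ j" if "i \<le> n" for i j
      using xy(4)[of "(n - i, j)"] dual_row[of "n - i" p j] that \<open>0 < n\<close>
      by (simp add: y N_def c'_def grid_reverse cong: sum.cong)
    show "(\<Sum>l\<le>n. (\<beta> + (T - grid T n l) *\<^sub>R b) \<bullet> p l) \<le> (\<Sum>l\<le>n. (\<gamma> + (T - grid T n l) *\<^sub>R c) \<bullet> u l) + \<epsilon>"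
      using xy(5) unfolding primal_obj[symmetric] dual_obj[symmetric] by (simp add: x y cong: sum.cong)
    show "\<alpha> * (\<Sum>i\<le>n. \<Sum>j\<in>UNIV. u i $ j) \<le> gap + \<epsilon>"
      using bound(1) gap unfolding sum_flat[symmetric] by (simp add: x)
    show "\<alpha> * (\<Sum>i\<le>n. \<Sum>k\<in>UNIV. p i $ k) \<le> gap + \<epsilon>"
      using bound(2) gap unfolding sum_flat_rev[symmetric] by (simp add: y cong: sum.cong)
  qed
qed

section \<open>Refining the grid\<close>

lemma right_cont_le:
  fixes f g :: "real \<Rightarrow> real"
  assumes cont: "continuous (at_right t) f" "continuous (at_right t) g"
    and "t < b" "countable D" and le: "\<And>x. x \<in> {t<..<b} - D \<Longrightarrow> f x \<le> g x"
  shows "f t \<le> g t"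
proof (rule ccontr)
  assume "\<not> f t \<le> g t"
  then have "0 < f t - g t" by simp
  moreover have "((\<lambda>x. f x - g x) \<longlongrightarrow> f t - g t) (at_right t)"
    using cont by (auto simp: continuous_within intro: tendsto_diff)
  ultimately have "\<forall>\<^sub>F x in at_right t. 0 < f x - g x"
    by (rule order_tendstoD(1)[rotated])
  then obtain d where d: "d > t" "\<And>x. t < x \<Longrightarrow> x < d \<Longrightarrow> 0 < f x - g x"
    by (auto simp: eventually_at_right_field)
  have "uncountable {t<..<min b d}"
    using d(1) \<open>t < b\<close> by (simp add: uncountable_open_interval)
  then obtain x where "x \<in> {t<..<min b d}" "x \<notin> D"
    using countable_subset[OF _ \<open>countable D\<close>] by blast
  with le[of x] d(2)[of x] show False by auto
qed

text \<open>
  Helly's theorem for one component at a time, passing to a further subsequence each time. The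
  exceptional set collects the discontinuities of all limits.
\<close>

lemma Helly_selection_finite:
  fixes f :: "'i \<Rightarrow> nat \<Rightarrow> real \<Rightarrow> real"
  assumes "finite I"
    and "\<And>i n x. i \<in> I \<Longrightarrow> continuous (at_right x) (f i n)" "\<And>i n. i \<in> I \<Longrightarrow> mono (f i n)"
    and "\<And>i n x. i \<in> I \<Longrightarrow> \<bar>f i n x\<bar> \<le> C"
  shows "\<exists>s F D. strict_mono (s :: nat \<Rightarrow> nat) \<and> countable D \<and>
    (\<forall>i\<in>I. (\<forall>x. continuous (at_right x) (F i)) \<and> mono (F i) \<and>
      (\<forall>x. x \<notin> D \<longrightarrow> (\<lambda>n. f i (s n) x) \<longlonglongrightarrow> F i x))"
  using assms
proof (induction I rule: finite_induct)
  case empty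
  show ?case
    by (intro exI[of _ id] exI[of _ undefined] exI[of _ "{}"]) (simp add: strict_mono_id)
next
  case (insert k I)
  then have "\<exists>s F D. strict_mono (s :: nat \<Rightarrow> nat) \<and> countable D \<and>
    (\<forall>i\<in>I. (\<forall>x. continuous (at_right x) (F i)) \<and> mono (F i) \<and>
      (\<forall>x. x \<notin> D \<longrightarrow> (\<lambda>n. f i (s n) x) \<longlonglongrightarrow> F i x))"
    by (intro insert.IH) auto
  then obtain s F D where s: "strict_mono (s :: nat \<Rightarrow> nat)" and D: "countable D"
    and F: "\<And>i x. i \<in> I \<Longrightarrow> continuous (at_right x) (F i)" "\<And>i. i \<in> I \<Longrightarrow> mono (F i)"
      "\<And>i x. i \<in> I \<Longrightarrow> x \<notin> D \<Longrightarrow> (\<lambda>n. f i (s n) x) \<longlonglongrightarrow> F i x"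
    by blast
  obtain r G where r: "strict_mono (r :: nat \<Rightarrow> nat)"
    and G: "\<And>x. continuous (at_right x) G" "mono G"
      "\<And>x. continuous (at x) G \<Longrightarrow> (\<lambda>n. f k (s (r n)) x) \<longlonglongrightarrow> G x"
    using Helly_selection[of "\<lambda>n. f k (s n)" C] insert.prems by auto
  define D' where "D' = D \<union> {x. \<not> continuous (at x) G}"
  have "countable D'"
    using D mono_ctble_discont[OF G(2)] by (simp add: D'_def)
  moreover have "strict_mono (\<lambda>n. s (r n))"
    using s r by (simp add: strict_mono_def)
  moreover have "(\<lambda>n. f i (s (r n)) x) \<longlonglongrightarrow> F i x" if "i \<in> I" "x \<notin> D'" for i x
    using LIMSEQ_subseq_LIMSEQ[OF F(3) r, of i x] that by (auto simp: D'_def o_def)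
  ultimately show ?case
    using F(1,2) G insert.hyps
    by (intro exI[of _ "\<lambda>n. s (r n)"] exI[of _ "F(k := G)"] exI[of _ D']) (auto simp: D'_def)
qed

text \<open>
  The endpoint \<open>T\<close> is never exceptional although the limit may jump there: all functions are constant
  from \<open>T\<close> on, so the values at \<open>T\<close> are also those at later points of convergence, and these
  determine the right-continuous limit at \<open>T\<close>.
\<close>

lemma monotone_vector_limit:
  fixes f :: "nat \<Rightarrow> real \<Rightarrow> real^'i"
  assumes "0 < T"
    and rc: "\<And>n t i. continuous (at_right t) (\<lambda>t. f n t $ i)"
    and mono: "\<And>n i. mono (\<lambda>t. f n t $ i)"
    and nonneg: "\<And>n t i. 0 \<le> f n t $ i" and bound: "\<And>n t i. f n t $ i \<le> C"
    and const: "\<And>n t. T \<le> t \<Longrightarrow> f n t = f n T"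
  shows "\<exists>s D V. strict_mono (s :: nat \<Rightarrow> nat) \<and> countable D \<and> T \<notin> D \<and> admissible T V \<and>
    (\<forall>i. mono (\<lambda>t. V t $ i)) \<and> (\<forall>t i. continuous (at_right t) (\<lambda>t. V t $ i)) \<and>
    (\<forall>t. t \<notin> D \<longrightarrow> (\<lambda>n. f (s n) t) \<longlonglongrightarrow> V t)"
proof -
  have "\<exists>s F D. strict_mono (s :: nat \<Rightarrow> nat) \<and> countable D \<and>
    (\<forall>i\<in>UNIV. (\<forall>x. continuous (at_right x) (F i)) \<and> mono (F i) \<and>
      (\<forall>x. x \<notin> D \<longrightarrow> (\<lambda>n. f (s n) x $ i) \<longlonglongrightarrow> F i x))"
    by (rule Helly_selection_finite[where f = "\<lambda>i n t. f n t $ i" and C = C])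
      (use rc mono nonneg bound in auto)
  then obtain s F D where s: "strict_mono (s :: nat \<Rightarrow> nat)" and D: "countable D"
    and F: "\<And>i x. continuous (at_right x) (F i)" "\<And>i. mono (F i)"
      "\<And>i x. x \<notin> D \<Longrightarrow> (\<lambda>n. f (s n) x $ i) \<longlonglongrightarrow> F i x"
    by simp blast
  define V where "V t = (\<chi> i. F i t)" for t
  have lim: "(\<lambda>n. f (s n) t) \<longlonglongrightarrow> V t" if "t \<notin> D" for t
    unfolding V_def using F(3)[OF that] by (auto intro!: vec_tendstoI)
  have F_nonneg: "0 \<le> F i t" for i t
    by (rule right_cont_le[of t "\<lambda>_. 0" "F i" "t + 1" D])
      (use F D nonneg in \<open>auto intro!: LIMSEQ_le_const[OF F(3)]\<close>)
  have limT: "(\<lambda>n. f (s n) T) \<longlonglongrightarrow> V T"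
  proof (rule vec_tendstoI)
    fix i
    obtain t where t: "t > T" "t \<notin> D"
      using countable_subset[OF _ D, of "{T<..<T+1}"] uncountable_open_interval[of T "T + 1"] by force
    have lim_after: "(\<lambda>n. f (s n) T $ i) \<longlonglongrightarrow> F i x" if "x > T" "x \<notin> D" for x
      using F(3)[OF that(2), of i] const[of x] that(1) by simp
    have eq: "F i x = F i t" if "x > T" "x \<notin> D" for x
      using lim_after[OF that] lim_after[OF t] by (rule LIMSEQ_unique)
    have "F i T = F i t"
    proof (rule antisym)
      show "F i T \<le> F i t"
        using t F(2)[of i] by (auto simp: mono_def)
      show "F i t \<le> F i T"
        by (rule right_cont_le[of T "\<lambda>_. F i t" "F i" "T + 1" D]) (use F(1) D eq in auto)
    qed
    with lim_after[OF t] show "(\<lambda>n. f (s n) T $ i) \<longlonglongrightarrow> V T $ i"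
      by (simp add: V_def)
  qed
  have "continuous (at_right t) V" for t
    using F(1) unfolding continuous_within V_def by (auto intro!: vec_tendstoI)
  then have adm: "admissible T V"
    using F(2) F_nonneg by (auto simp: admissible_def mono_on_def less_eq_vec_def V_def mono_def)
  have "(\<lambda>n. f (s n) t) \<longlonglongrightarrow> V t" if "t \<notin> D - {T}" for t
    using that lim limT by (cases "t = T") auto
  then show ?thesis
    using s D F adm
    by (intro exI[of _ s] exI[of _ "D - {T}"] exI[of _ V]) (auto simp: V_def)
qed

lemma tendsto_affine_value:
  fixes f :: "nat \<Rightarrow> real \<Rightarrow> real^'i"
  assumes "countable D" "T \<notin> D" and lim: "\<And>t. t \<notin> D \<Longrightarrow> (\<lambda>n. f n t) \<longlonglongrightarrow> V t"
    and mono: "\<And>n i. mono (\<lambda>t. f n t $ i)" "\<And>i. mono (\<lambda>t. V t $ i)"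
    and bound: "\<And>n t i. \<bar>f n t $ i\<bar> \<le> C"
  shows "(\<lambda>n. affine_value T \<gamma> c (f n)) \<longlonglongrightarrow> affine_value T \<gamma> c V"
proof -
  have [measurable]: "(\<lambda>t. f n t $ i) \<in> borel_measurable borel" "(\<lambda>t. V t $ i) \<in> borel_measurable borel" for n i
    using mono by (auto intro: borel_measurable_mono)
  have "(\<lambda>n. LINT t:{0..T}|lborel. f n t $ i) \<longlonglongrightarrow> (LINT t:{0..T}|lborel. V t $ i)" for i
    unfolding set_lebesgue_integral_def
  proof (rule integral_dominated_convergence)
    show "integrable lborel (\<lambda>t. indicat_real {0..T} t * C)"
      by (intro integrable_mult_left integrable_real_indicator) (auto simp: emeasure_lborel_Icc_eq)
    have "AE t in lborel. t \<notin> D"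
      using countable_imp_null_set_lborel[OF \<open>countable D\<close>] by (rule AE_not_in)
    then show "AE t in lborel. (\<lambda>n. indicat_real {0..T} t *\<^sub>R f n t $ i) \<longlonglongrightarrow> indicat_real {0..T} t *\<^sub>R V t $ i"
      by eventually_elim (intro tendsto_intros lim)
    show "AE t in lborel. norm (indicat_real {0..T} t *\<^sub>R f n t $ i) \<le> indicat_real {0..T} t * C" for n
      using bound by (auto simp: indicator_def)
  qed measurable
  then show ?thesis
    unfolding affine_value_def by (intro tendsto_intros lim \<open>T \<notin> D\<close>)
qed

text \<open>
  At exceptional points, which lie before \<open>T\<close> or outside \<open>[0,T]\<close>, the constraint is inherited from the
  right by right-continuity.
\<close>

lemma limit_satisfies_constraints:
  fixes f :: "nat \<Rightarrow> real \<Rightarrow> real^'i" and B :: "real^'i^'m"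
  assumes "countable D" "T \<notin> D" and lim: "\<And>t. t \<notin> D \<Longrightarrow> (\<lambda>n. f n t) \<longlonglongrightarrow> V t"
    and rc: "\<And>t i. continuous (at_right t) (\<lambda>t. V t $ i)"
    and approx: "\<And>n t. t \<in> {0..T} \<Longrightarrow> (B *v f n t) $ k \<le> r + t * q + e n * \<bar>q\<bar>"
    and e: "e \<longlonglongrightarrow> 0" and t: "t \<in> {0..T}"
  shows "(B *v V t) $ k \<le> r + t * q"
proof -
  have comp: "(B *v x) $ k = (\<Sum>i\<in>UNIV. B $ k $ i * x $ i)" for x
    by (simp add: matrix_vector_mult_def)
  have off_D: "(B *v V t) $ k \<le> r + t * q" if "t \<in> {0..T}" "t \<notin> D" for t
  proof (rule LIMSEQ_le)
    show "(\<lambda>n. (B *v f n t) $ k) \<longlonglongrightarrow> (B *v V t) $ k"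
      unfolding comp by (intro tendsto_intros lim that)
    have "(\<lambda>n. r + t * q + e n * \<bar>q\<bar>) \<longlonglongrightarrow> r + t * q + 0 * \<bar>q\<bar>"
      by (intro tendsto_intros e)
    then show "(\<lambda>n. r + t * q + e n * \<bar>q\<bar>) \<longlonglongrightarrow> r + t * q" by simp
    show "\<exists>N. \<forall>n\<ge>N. (B *v f n t) $ k \<le> r + t * q + e n * \<bar>q\<bar>"
      using approx[OF that(1)] by blast
  qed
  show ?thesis
  proof (cases "t < T")
    case True
    show ?thesis
    proof (rule right_cont_le[where f = "\<lambda>t. (B *v V t) $ k"])
      show "continuous (at_right t) (\<lambda>t. (B *v V t) $ k)"
        unfolding comp using rc by (auto simp: continuous_within intro!: tendsto_sum tendsto_mult tendsto_const)
      show "continuous (at_right t) (\<lambda>t. r + t * q)"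
        by (intro continuous_intros)
      show "(B *v V x) $ k \<le> r + x * q" if "x \<in> {t<..<T} - D" for x
        using that t by (intro off_D) auto
    qed (use True \<open>countable D\<close> in auto)
  next
    case False
    then show ?thesis
      using t \<open>T \<notin> D\<close> by (intro off_D) auto
  qed
qed

text \<open>
  Between grid points the right-hand side has moved by at most the mesh size times \<open>\<bar>q\<bar>\<close>.
\<close>

lemma step_fun_constraints:
  fixes u :: "nat \<Rightarrow> real^'i" and B :: "real^'i^'m"
  assumes "0 < T" "0 < n" "t \<in> {0..T}"
    and "\<And>i. i \<le> n \<Longrightarrow> (B *v (\<Sum>l\<le>i. u l)) $ k \<le> r + grid T n i * q"
  shows "(B *v step_fun T n u t) $ k \<le> r + t * q + T / real n * \<bar>q\<bar>"
proof -
  obtain i where i: "i \<le> n" "step_fun T n u t = (\<Sum>l\<le>i. u l)" "grid T n i \<le> t" "t \<le> grid T n i + T / real n"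
    using step_fun_eq_partial_sum[of T n t u] assms by auto
  have "(grid T n i - t) * q \<le> \<bar>grid T n i - t\<bar> * \<bar>q\<bar>"
    by (metis abs_ge_self abs_mult)
  also have "\<dots> \<le> T / real n * \<bar>q\<bar>"
    using i by (intro mult_right_mono) auto
  finally show ?thesis
    using assms(4)[OF i(1)] i(2) by (simp add: algebra_simps)
qed

text \<open>
  The \<open>m\<close>-th discretisation has \<open>Suc m\<close> steps and is solved up to a gap of \<open>1 / Suc m\<close>; the smaller of
  the two slacks bounds its solutions on both sides.
\<close>

lemma mclp_strong_duality:
  fixes A :: "real^'j^'k"
  assumes T: "0 < T" and primal: "mclp_strictly_feasible T A \<beta> b"
    and dual: "mclp_dual_strictly_feasible T A \<gamma> c"
  obtains U P where "mclp_feasible T A \<beta> b U" "mclp_dual_feasible T A \<gamma> c P"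
    "mclp_objective T \<gamma> c U = mclp_dual_objective T \<beta> b P"
proof -
  obtain U0 \<alpha>1 where U0: "mclp_feasible T A \<beta> b U0" "0 < \<alpha>1"
    "\<And>t k. t \<in> {0..T} \<Longrightarrow> (\<beta> + t *\<^sub>R b - A *v U0 t) $ k \<ge> \<alpha>1"
    using primal by (auto simp: mclp_strictly_feasible_def)
  obtain P0 \<alpha>2 where P0: "mclp_dual_feasible T A \<gamma> c P0" "0 < \<alpha>2"
    "\<And>t j. t \<in> {0..T} \<Longrightarrow> (transpose A *v P0 t - \<gamma> - t *\<^sub>R c) $ j \<ge> \<alpha>2"
    using dual by (auto simp: mclp_dual_strictly_feasible_def)
  define \<alpha> where "\<alpha> = min \<alpha>1 \<alpha>2"
  have "0 < \<alpha>" using U0(2) P0(2) by (simp add: \<alpha>_def)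
  have slack: "(A *v U0 t) $ k + \<alpha> \<le> \<beta> $ k + t * b $ k"
    "\<gamma> $ j + t * c $ j + \<alpha> \<le> (transpose A *v P0 t) $ j" if "t \<in> {0..T}" for t j k
    using U0(3)[OF that, of k] P0(3)[OF that, of j] by (auto simp: \<alpha>_def)
  have adm0: "admissible T U0" "admissible T P0"
    using U0 P0 by (auto simp: mclp_feasible_def mclp_dual_feasible_def)
  define gap where "gap = (\<Sum>k\<in>UNIV. (\<bar>\<beta> $ k\<bar> + T * \<bar>b $ k\<bar>) * P0 T $ k) +
    (\<Sum>j\<in>UNIV. (\<bar>\<gamma> $ j\<bar> + T * \<bar>c $ j\<bar>) * U0 T $ j)"
  define C where "C = (gap + 1) / \<alpha>"
  define good where "good m u p \<longleftrightarrow>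
    (\<forall>i\<le>Suc m. \<forall>j. 0 \<le> u i $ j) \<and> (\<forall>i\<le>Suc m. \<forall>k. 0 \<le> p i $ k) \<and>
    (\<forall>i\<le>Suc m. \<forall>k. (A *v (\<Sum>l\<le>i. u l)) $ k \<le> \<beta> $ k + grid T (Suc m) i * b $ k) \<and>
    (\<forall>i\<le>Suc m. \<forall>j. \<gamma> $ j + grid T (Suc m) i * c $ j \<le> (transpose A *v (\<Sum>l\<le>i. p l)) $ j) \<and>
    affine_value T \<beta> b (step_fun T (Suc m) p) \<le> affine_value T \<gamma> c (step_fun T (Suc m) u) + 1 / real (Suc m) \<and>
    (\<Sum>i\<le>Suc m. \<Sum>j\<in>UNIV. u i $ j) \<le> C \<and> (\<Sum>i\<le>Suc m. \<Sum>k\<in>UNIV. p i $ k) \<le> C" for m u p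
  have "\<exists>u p. good m u p" for m
  proof (rule discrete_near_duality[OF T zero_less_Suc _ less_imp_le[OF \<open>0 < \<alpha>\<close>] adm0(1) slack(1) adm0(2) slack(2), of "1 / real (Suc m)" m])
    fix u :: "nat \<Rightarrow> real^'j" and p :: "nat \<Rightarrow> real^'k"
    assume 1: "\<And>i j. i \<le> Suc m \<Longrightarrow> 0 \<le> u i $ j" "\<And>i k. i \<le> Suc m \<Longrightarrow> 0 \<le> p i $ k"
      "\<And>i k. i \<le> Suc m \<Longrightarrow> (A *v (\<Sum>l\<le>i. u l)) $ k \<le> \<beta> $ k + grid T (Suc m) i * b $ k"
      "\<And>i j. i \<le> Suc m \<Longrightarrow> \<gamma> $ j + grid T (Suc m) i * c $ j \<le> (transpose A *v (\<Sum>l\<le>i. p l)) $ j"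
      "(\<Sum>l\<le>Suc m. (\<beta> + (T - grid T (Suc m) l) *\<^sub>R b) \<bullet> p l) \<le> (\<Sum>l\<le>Suc m. (\<gamma> + (T - grid T (Suc m) l) *\<^sub>R c) \<bullet> u l) + 1 / real (Suc m)"
    assume 2: "\<alpha> * (\<Sum>i\<le>Suc m. \<Sum>j\<in>UNIV. u i $ j) \<le> (\<Sum>k\<in>UNIV. (\<bar>\<beta> $ k\<bar> + T * \<bar>b $ k\<bar>) * P0 T $ k) +
    (\<Sum>j\<in>UNIV. (\<bar>\<gamma> $ j\<bar> + T * \<bar>c $ j\<bar>) * U0 T $ j) + 1 / real (Suc m)"
      "\<alpha> * (\<Sum>i\<le>Suc m. \<Sum>k\<in>UNIV. p i $ k) \<le> (\<Sum>k\<in>UNIV. (\<bar>\<beta> $ k\<bar> + T * \<bar>b $ k\<bar>) * P0 T $ k) +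
    (\<Sum>j\<in>UNIV. (\<bar>\<gamma> $ j\<bar> + T * \<bar>c $ j\<bar>) * U0 T $ j) + 1 / real (Suc m)"
    have "1 / real (Suc m) \<le> 1" by simp
    with 2 have "\<alpha> * (\<Sum>i\<le>Suc m. \<Sum>j\<in>UNIV. u i $ j) \<le> gap + 1" "\<alpha> * (\<Sum>i\<le>Suc m. \<Sum>k\<in>UNIV. p i $ k) \<le> gap + 1"
      unfolding gap_def by linarith+
    then have "(\<Sum>i\<le>Suc m. \<Sum>j\<in>UNIV. u i $ j) \<le> C" "(\<Sum>i\<le>Suc m. \<Sum>k\<in>UNIV. p i $ k) \<le> C"
      using \<open>0 < \<alpha>\<close> unfolding C_def by (simp_all only: pos_le_divide_eq mult.commute)
    with 1 show "\<exists>u p. good m u p"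
      unfolding good_def affine_value_step_fun[OF T] by blast
  qed auto
  then obtain u p where "\<And>m. good m (u m) (p m)" by metis
  then have up: "\<And>m i j. i \<le> Suc m \<Longrightarrow> 0 \<le> u m i $ j" "\<And>m i k. i \<le> Suc m \<Longrightarrow> 0 \<le> p m i $ k"
    and feas: "\<And>m i k. i \<le> Suc m \<Longrightarrow> (A *v (\<Sum>l\<le>i. u m l)) $ k \<le> \<beta> $ k + grid T (Suc m) i * b $ k"
      "\<And>m i j. i \<le> Suc m \<Longrightarrow> \<gamma> $ j + grid T (Suc m) i * c $ j \<le> (transpose A *v (\<Sum>l\<le>i. p m l)) $ j"
    and near: "\<And>m. affine_value T \<beta> b (step_fun T (Suc m) (p m)) \<le> affine_value T \<gamma> c (step_fun T (Suc m) (u m)) + 1 / real (Suc m)"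
    and total: "\<And>m. (\<Sum>i\<le>Suc m. \<Sum>j\<in>UNIV. u m i $ j) \<le> C" "\<And>m. (\<Sum>i\<le>Suc m. \<Sum>k\<in>UNIV. p m i $ k) \<le> C"
    unfolding good_def by blast+
  define f where "f m = step_fun T (Suc m) (u m)" for m
  define g where "g m = step_fun T (Suc m) (p m)" for m
  have f: "mono (\<lambda>t. f m t $ j)" "continuous (at_right t) (\<lambda>t. f m t $ j)" "0 \<le> f m t $ j" "f m t $ j \<le> C" for m t j
    unfolding f_def using up total
    by (auto intro!: mono_step_fun right_cont_step_fun step_fun_bounds)
  have g: "mono (\<lambda>t. g m t $ k)" "continuous (at_right t) (\<lambda>t. g m t $ k)" "0 \<le> g m t $ k" "g m t $ k \<le> C" for m t k
    unfolding g_def using up total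
    by (auto intro!: mono_step_fun right_cont_step_fun step_fun_bounds)
  have const: "f m t = f m T" "g m t = g m T" if "T \<le> t" for m t
    using T that by (auto simp: f_def g_def step_fun_after)
  obtain s1 D1 U where s1: "strict_mono (s1 :: nat \<Rightarrow> nat)" and D1: "countable D1" "T \<notin> D1" and U: "admissible T U"
    "\<And>j. mono (\<lambda>t. U t $ j)" "\<And>t j. continuous (at_right t) (\<lambda>t. U t $ j)"
    and lim1: "\<And>t. t \<notin> D1 \<Longrightarrow> (\<lambda>m. f (s1 m) t) \<longlonglongrightarrow> U t"
    using monotone_vector_limit[of T f C, OF T f(2,1,3,4) const(1)] by blast
  obtain s2 D2 P where s2: "strict_mono (s2 :: nat \<Rightarrow> nat)" and D2: "countable D2" "T \<notin> D2" and P: "admissible T P"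
    "\<And>k. mono (\<lambda>t. P t $ k)" "\<And>t k. continuous (at_right t) (\<lambda>t. P t $ k)"
    and lim2: "\<And>t. t \<notin> D2 \<Longrightarrow> (\<lambda>m. g (s1 (s2 m)) t) \<longlonglongrightarrow> P t"
    using monotone_vector_limit[of T "\<lambda>m. g (s1 m)" C, OF T g(2,1,3,4) const(2)] by blast
  \<comment> \<open>A common subsequence is needed to compare the objectives of the two limits.\<close>
  define s where "s m = s1 (s2 m)" for m
  have s: "strict_mono s" using s1 s2 by (simp add: strict_mono_def s_def)
  have limU: "(\<lambda>m. f (s m) t) \<longlonglongrightarrow> U t" if "t \<notin> D1" for t
    using LIMSEQ_subseq_LIMSEQ[OF lim1[OF that] s2] by (simp add: o_def s_def)
  have limP: "(\<lambda>m. g (s m) t) \<longlonglongrightarrow> P t" if "t \<notin> D2" for t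
    using lim2[OF that] by (simp add: s_def)
  have mesh: "(\<lambda>m. a / real (Suc (s m))) \<longlonglongrightarrow> 0" for a
  proof -
    have "(\<lambda>m. a * (1 / real (Suc m))) \<longlonglongrightarrow> a * 0"
      using LIMSEQ_inverse_real_of_nat by (intro tendsto_intros) (simp add: inverse_eq_divide)
    then have "(\<lambda>m. a / real (Suc m)) \<longlonglongrightarrow> 0" by simp
    from LIMSEQ_subseq_LIMSEQ[OF this s] show ?thesis by (simp add: o_def)
  qed
  have "(A *v U t) $ k \<le> \<beta> $ k + t * b $ k" if "t \<in> {0..T}" for t k
  proof (rule limit_satisfies_constraints[OF D1 limU U(3) _ mesh that])
    show "(A *v f (s m) t) $ k \<le> \<beta> $ k + t * b $ k + T / real (Suc (s m)) * \<bar>b $ k\<bar>" if "t \<in> {0..T}" for m t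
      unfolding f_def using T that feas(1) by (intro step_fun_constraints) auto
  qed
  then have U_feas: "mclp_feasible T A \<beta> b U"
    using U(1) by (auto simp: mclp_feasible_def less_eq_vec_def)
  have neg: "((- transpose A) *v x) $ j = - (transpose A *v x) $ j" for x j
    by (simp add: matrix_vector_mult_def sum_negf)
  \<comment> \<open>The dual constraints are lower bounds, so they pass to the limit in negated form.\<close>
  have neg_limit: "((- transpose A) *v P t) $ j \<le> - \<gamma> $ j + t * (- c $ j)" if "t \<in> {0..T}" for t j
  proof (rule limit_satisfies_constraints[OF D2 limP P(3) _ mesh that])
    show "((- transpose A) *v g (s m) t) $ j \<le> - \<gamma> $ j + t * (- c $ j) + T / real (Suc (s m)) * \<bar>- c $ j\<bar>"
      if "t \<in> {0..T}" for m t
      unfolding g_def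
    proof (intro step_fun_constraints)
      show "((- transpose A) *v (\<Sum>l\<le>i. p (s m) l)) $ j \<le> - \<gamma> $ j + grid T (Suc (s m)) i * - c $ j"
        if "i \<le> Suc (s m)" for i
        using feas(2)[OF that, of j] by (simp add: neg)
    qed (use T that in auto)
  qed
  have "\<gamma> $ j + t * c $ j \<le> (transpose A *v P t) $ j" if "t \<in> {0..T}" for t j
    using neg_limit[OF that, of j] by (simp add: neg)
  then have P_feas: "mclp_dual_feasible T A \<gamma> c P"
    using P(1) by (auto simp: mclp_dual_feasible_def less_eq_vec_def)
  have "affine_value T \<beta> b P \<le> affine_value T \<gamma> c U + 0"
  proof (rule LIMSEQ_le)
    show "(\<lambda>m. affine_value T \<beta> b (g (s m))) \<longlonglongrightarrow> affine_value T \<beta> b P"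
      by (rule tendsto_affine_value[OF D2 limP _ P(2), where C = C]) (use g in auto)
    have "(\<lambda>m. affine_value T \<gamma> c (f (s m))) \<longlonglongrightarrow> affine_value T \<gamma> c U"
      by (rule tendsto_affine_value[OF D1 limU _ U(2), where C = C]) (use f in auto)
    then show "(\<lambda>m. affine_value T \<gamma> c (f (s m)) + 1 / real (Suc (s m))) \<longlonglongrightarrow> affine_value T \<gamma> c U + 0"
      by (intro tendsto_add mesh)
    show "\<exists>N. \<forall>m\<ge>N. affine_value T \<beta> b (g (s m)) \<le> affine_value T \<gamma> c (f (s m)) + 1 / real (Suc (s m))"
      using near unfolding f_def g_def by blast
  qed
  then have "mclp_dual_objective T \<beta> b P \<le> mclp_objective T \<gamma> c U"
    using T U(1) P(1) by (simp add: mclp_objective_eq_affine_value mclp_dual_objective_eq_affine_value)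
  with mclp_weak_duality[OF T U_feas P_feas] show thesis
    by (intro that[OF U_feas P_feas]) auto
qed

theorem theorem4p7:
  fixes T :: real and A :: "real^'j^'k"
    and \<beta> b :: "real^'k" and \<gamma> c :: "real^'j"
  assumes "T > 0"
    and "mclp_strictly_feasible T A \<beta> b"
    and "mclp_dual_strictly_feasible T A \<gamma> c"
  shows "(\<exists>U. mclp_optimal T A \<beta> b \<gamma> c U) \<and>
         (\<exists>P. mclp_dual_optimal T A \<beta> b \<gamma> c P) \<and>
         mclp_value T A \<beta> b \<gamma> c = mclp_dual_value T A \<beta> b \<gamma> c"
proof -
  obtain U P where U: "mclp_feasible T A \<beta> b U" and P: "mclp_dual_feasible T A \<gamma> c P"
    and eq: "mclp_objective T \<gamma> c U = mclp_dual_objective T \<beta> b P"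
    using mclp_strong_duality[OF assms] .
  have U_opt: "mclp_objective T \<gamma> c V \<le> mclp_objective T \<gamma> c U" if "mclp_feasible T A \<beta> b V" for V
    using mclp_weak_duality[OF assms(1) that P] eq by simp
  have P_opt: "mclp_dual_objective T \<beta> b P \<le> mclp_dual_objective T \<beta> b Q" if "mclp_dual_feasible T A \<gamma> c Q" for Q
    using mclp_weak_duality[OF assms(1) U that] eq by simp
  have "mclp_value T A \<beta> b \<gamma> c = ereal (mclp_objective T \<gamma> c U)"
    unfolding mclp_value_def using U U_opt by (intro antisym SUP_least SUP_upper2[of U]) auto
  moreover have "mclp_dual_value T A \<beta> b \<gamma> c = ereal (mclp_dual_objective T \<beta> b P)"
    unfolding mclp_dual_value_def using P P_opt by (intro antisym INF_greatest INF_lower2[of P]) auto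
  ultimately show ?thesis
    using U P U_opt P_opt eq unfolding mclp_optimal_def mclp_dual_optimal_def by auto
qed

end
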